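(* Let $r\ge1$ and let $T$ be a tree with $\operatorname{diam}(T)=2r+1$ and $|V(T)|=n$. Then there exists a double spider $D=\operatorname{DS}(a_1,\dots,a_p;b_1,\dots,b_q)$ with $n$ vertices and diameter $2r+1$ such that (i) $a_1=b_1=r$; (ii) every $a_i$ and every $b_j$ is at most $r$; (iii) $\lambda_2(T)\le\lambda_2(D)$; and moreover, if $\lambda_2(T)=\lambda_2(D)$, then $T$ itself is a double spider.
   Context: A double spider $\operatorname{DS}(a_1,\dots,a_p;b_1,\dots,b_q)$ ($p,q\ge1$, $a_1\ge\dots\ge a_p\ge1$, $b_1\ge\dots\ge b_q\ge1$) is the tree obtained from two vertices $u,v$ joined by an edge by attaching at $u$ internally disjoint paths of lengths $a_1,\dots,a_p$ and at $v$ internally disjoint paths of lengths $b_1,\dots,b_q$. For a tree $T=(V,E)$ with leaf set $\delta\Omega$ (the boundary), the harmonic extension $\widehat g$ of $g\colon\delta\Omega\to\mathbb R$ is the unique function on $V$ equal to $g$ on $\delta\Omega$ with $\sum_{w\sim v}(\widehat g(v)-\widehat g(w))=0$ at every non-leaf $v$, and $\lambda_2(T)=\min\{\sum_{xy\in E}(\widehat g(x)-\widehat g(y))^2/\sum_\omega g(\omega)^2: g\ne0,\ \sum_\omega g(\omega)=0\}$ is the first nonzero Steklov eigenvalue. *)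

theory Defs
  imports Complex_Main "HOL-Library.FuncSet" "Graph_Theory.Graph_Theory"
begin

text \<open>
  A finite simple graph is a \<^locale>\<open>pair_graph\<close>: a finite, loop-free, symmetric
  set of arcs, where an undirected edge is represented by its two opposite arcs.
\<close>

subsection \<open>Trees, diameter and leaves\<close>

text \<open>
  In a symmetric digraph, walking along an edge and straight back is a
  \<^const>\<open>pre_digraph.cycle\<close> of length 2, so the library predicate \<^const>\<open>tree\<close>
  fails for every graph with an edge. The cycles of the undirected graph
  are exactly the \<^const>\<open>pre_digraph.cycle\<close>s of length at least 3.
\<close>

definition tree_graph :: "'a pair_pre_digraph \<Rightarrow> bool" where
  "tree_graph G \<longleftrightarrow> pair_graph G \<and> Digraph_Component.connected (with_proj G) \<and>
     \<not> (\<exists>p. pre_digraph.cycle (with_proj G) p \<and> 3 \<le> length p)"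

text \<open>\<^const>\<open>wf_digraph.\<mu>\<close> with unit weights is the graph distance.\<close>

definition graph_diameter :: "'a pair_pre_digraph \<Rightarrow> ereal" where
  "graph_diameter G =
     (SUP u\<in>pverts G. SUP v\<in>pverts G. wf_digraph.\<mu> (with_proj G) (\<lambda>_. 1) u v)"

definition leaves :: "'a pair_pre_digraph \<Rightarrow> 'a set" where
  "leaves G = {v \<in> pverts G. out_degree (with_proj G) v = 1}"


subsection \<open>The first nonzero Steklov eigenvalue\<close>

text \<open>
  Only the values of \<open>g\<close> on the leaves matter. Harmonic extensions are
  functions on the vertex set, hence the restriction to \<^const>\<open>extensional\<close>
  functions, without which they would not be unique.
\<close>

definition harmonic_extension ::
    "'a pair_pre_digraph \<Rightarrow> ('a \<Rightarrow> real) \<Rightarrow> 'a \<Rightarrow> real" where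
  "harmonic_extension G g = (THE h. h \<in> extensional (pverts G) \<and>
     (\<forall>v\<in>leaves G. h v = g v) \<and>
     (\<forall>v\<in>pverts G - leaves G. (\<Sum>w | (v, w) \<in> parcs G. h v - h w) = 0))"

text \<open>The factor 1/2 is there because \<^const>\<open>parcs\<close> contains every edge twice.\<close>

definition dirichlet_energy :: "'a pair_pre_digraph \<Rightarrow> ('a \<Rightarrow> real) \<Rightarrow> real" where
  "dirichlet_energy G h = (\<Sum>(x, y)\<in>parcs G. (h x - h y)\<^sup>2) / 2"

definition steklov_lambda2 :: "'a pair_pre_digraph \<Rightarrow> real" where
  "steklov_lambda2 G = (LEAST l. \<exists>g :: 'a \<Rightarrow> real.
     (\<exists>v\<in>leaves G. g v \<noteq> 0) \<and> (\<Sum>v\<in>leaves G. g v) = 0 \<and>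
     l = dirichlet_energy G (harmonic_extension G g) / (\<Sum>v\<in>leaves G. (g v)\<^sup>2))"


subsection \<open>Double spiders\<close>

text \<open>
  \<open>Hub True\<close> and \<open>Hub False\<close> are the adjacent vertices \<open>u\<close> and \<open>v\<close>;
  \<open>Leg s i k\<close> with \<open>k \<ge> 1\<close> is the vertex at distance \<open>k\<close> from \<open>Hub s\<close> on
  the \<open>i\<close>-th path attached there.
\<close>

datatype spider_vertex = Hub bool | Leg bool nat nat

fun leg_vertex :: "bool \<Rightarrow> nat \<Rightarrow> nat \<Rightarrow> spider_vertex" where
  "leg_vertex s i 0 = Hub s"
| "leg_vertex s i (Suc k) = Leg s i (Suc k)"

definition double_spider :: "nat list \<Rightarrow> nat list \<Rightarrow> spider_vertex pair_pre_digraph" where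
  "double_spider as bs =
     (let legs = (\<lambda>s. if s then as else bs);
          E = {(Hub True, Hub False)} \<union>
              {(leg_vertex s i k, leg_vertex s i (Suc k)) | s i k.
                 i < length (legs s) \<and> k < legs s ! i}
      in \<lparr> pverts = {Hub True, Hub False} \<union>
             {leg_vertex s i k | s i k. i < length (legs s) \<and> k \<le> legs s ! i},
           parcs = E \<union> E\<inverse> \<rparr>)"

definition spider_params :: "nat list \<Rightarrow> nat list \<Rightarrow> bool" where
  "spider_params as bs \<longleftrightarrow> as \<noteq> [] \<and> bs \<noteq> [] \<and>
     sorted_wrt (\<ge>) as \<and> sorted_wrt (\<ge>) bs \<and>
     (\<forall>a\<in>set as. 1 \<le> a) \<and> (\<forall>b\<in>set bs. 1 \<le> b)"

definition is_double_spider :: "'a pair_pre_digraph \<Rightarrow> bool" where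
  "is_double_spider G \<longleftrightarrow> (\<exists>as bs. spider_params as bs \<and>
     digraph_iso (with_proj G) (with_proj (double_spider as bs)))"

end

theory Submission
  imports Defs "HOL-Analysis.Function_Topology"
begin

text \<open>
  Let \<open>uv\<close> be the central edge of \<open>T\<close>; both components of \<open>T - uv\<close>, rooted at \<open>u\<close> and \<open>v\<close>,
  have depth \<open>r\<close>. Cut each of them into descending paths that end at the leaves, one of
  length \<open>r\<close> on each side, and let \<open>D\<close> be the double spider obtained by moving the upper ends
  of all these paths to the hubs. An eigenfunction \<open>h\<close> for \<open>\<lambda> = \<lambda>\<^sub>2(D)\<close> is linear on every leg,
  with slope \<open>\<lambda>\<close> times its value at the leaf; as \<open>\<lambda> r < 1\<close>, it moves away from zero along each
  leg, starting from a nonzero hub value. Glue the increments of \<open>h\<close> along the paths back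
  together in \<open>T\<close>. This keeps the energy and shifts the leaf values away from zero, which
  can only increase their variance, and does so strictly unless every path already starts
  at a hub, that is, unless \<open>T\<close> is \<open>D\<close>.
\<close>

section \<open>The variational characterisation of the first Steklov eigenvalue\<close>

text \<open>One sign carries the proof. On a leg of length \<open>a\<close> with hub value
  \<open>c\<close>, the leaf condition becomes
  \<open>slope * (1 - \<lambda> * a) = \<lambda> * c\<close>, so the slope has the sign of
  \<open>c\<close> once \<open>\<lambda> * a < 1\<close>. Hence no leg may exceed \<open>r\<close>,
  for which a path of \<open>2 * r + 1\<close> edges through both hubs serves as test function.
  Vertices other than the hubs stand for the edges above them, so cutting and moving paths keeps the
  vertex count and all increments; path ends stand for leaves, so boundary values can be compared
  one by one. What the gluing destroys is the zero sum on the leaves. Therefore \<lambda> is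
  characterised through the leaf variance of arbitrary functions, which ignores added
  constants.\<close>

lemma compact_PiE_Icc: "compact (V \<rightarrow>\<^sub>E {a..b::real})"
proof -
  \<comment> \<open>Extensional functions form a product over the whole type, with factor
    \<open>{undefined}\<close> outside \<open>V\<close>; Tychonoff's theorem then applies even to an
    infinite type.\<close>
  let ?K = "\<lambda>i. if i \<in> V then {a..b} else {undefined}"
  have eq: "(V \<rightarrow>\<^sub>E {a..b}) = PiE UNIV ?K"
    by (auto simp: PiE_iff extensional_def split: if_splits)
  have "compactin (product_topology (\<lambda>i. euclidean) UNIV) (PiE UNIV ?K)"
    unfolding compactin_PiE by auto
  then show ?thesis
    by (simp add: eq euclidean_product_topology)
qed

text \<open>The first-order condition at a minimum: \<open>b\<close> is the first variation, and for
  small \<open>t\<close> of the sign opposite to \<open>b\<close> the linear term would win.\<close>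

lemma linear_le_quadratic_imp_eq_0:
  fixes b c :: real
  assumes "\<And>t. 0 \<le> 2 * t * b + t\<^sup>2 * c"
  shows "b = 0"
proof (rule ccontr)
  assume b: "b \<noteq> 0"
  define m where "m = \<bar>c\<bar> + 1"
  have m: "m > 0" "c < m" by (auto simp: m_def)
  have "0 \<le> 2 * (- b / m) * b + (- b / m)\<^sup>2 * c" by (rule assms)
  also have "\<dots> = (b\<^sup>2 / m\<^sup>2) * (c - 2 * m)"
    using m by (simp add: field_simps power2_eq_square)
  also have "\<dots> < 0" using b m by (intro mult_pos_neg) auto
  finally show False by simp
qed

lemma sum_power2_diff_mean:
  fixes f :: "'a \<Rightarrow> real"
  assumes "finite A" "A \<noteq> {}"
  shows "(\<Sum>x\<in>A. (f x - sum f A / card A)\<^sup>2) = (\<Sum>x\<in>A. (f x)\<^sup>2) - (sum f A)\<^sup>2 / card A"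
proof -
  define m where "m = sum f A / card A"
  have "real (card A) > 0" using assms by (simp add: card_gt_0_iff)
  then have m: "sum f A = card A * m" by (simp add: m_def)
  have "(\<Sum>x\<in>A. (f x - m)\<^sup>2) = (\<Sum>x\<in>A. (f x)\<^sup>2) - (\<Sum>x\<in>A. f x) * (2 * m) + card A * m\<^sup>2"
    by (simp add: power2_diff sum.distrib sum_subtractf sum_distrib_left sum_distrib_right mult.commute mult.left_commute)
  also have "\<dots> = (\<Sum>x\<in>A. (f x)\<^sup>2) - (sum f A)\<^sup>2 / card A"
    unfolding m using \<open>real (card A) > 0\<close> by (simp add: power2_eq_square field_simps)
  finally show ?thesis by (simp add: m_def)
qed

text \<open>The common frame for \<open>T\<close> and \<open>D\<close>. Two distinct leaves provide
  a nonzero boundary function of sum zero.\<close>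

locale boundary_graph =
  fixes G :: "'a pair_pre_digraph"
  assumes finite_verts: "finite (pverts G)"
    and arcs_subset: "parcs G \<subseteq> pverts G \<times> pverts G"
    and arcs_sym: "(x, y) \<in> parcs G \<Longrightarrow> (y, x) \<in> parcs G"
    and connected: "x \<in> pverts G \<Longrightarrow> y \<in> pverts G \<Longrightarrow> (x, y) \<in> (parcs G)\<^sup>*"
    and two_leaves: "\<exists>x\<in>leaves G. \<exists>y\<in>leaves G. x \<noteq> y"
begin

abbreviation "V \<equiv> pverts G"
abbreviation "E \<equiv> parcs G"
abbreviation "L \<equiv> leaves G"
abbreviation "energy \<equiv> dirichlet_energy G"

definition laplacian :: "('a \<Rightarrow> real) \<Rightarrow> 'a \<Rightarrow> real" where
  "laplacian h v = (\<Sum>w | (v, w) \<in> E. h v - h w)"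

definition bilinear :: "('a \<Rightarrow> real) \<Rightarrow> ('a \<Rightarrow> real) \<Rightarrow> real" where
  "bilinear h k = (\<Sum>(x, y)\<in>E. (h x - h y) * (k x - k y)) / 2"

lemma finite_arcs: "finite E"
  using arcs_subset finite_verts finite_subset by blast

lemma leaves_subset: "L \<subseteq> V"
  by (auto simp: leaves_def)

lemma finite_leaves: "finite L"
  using leaves_subset finite_verts finite_subset by blast

lemma leaves_nonempty: "L \<noteq> {}"
  using two_leaves by auto

lemma energy_nonneg: "0 \<le> energy h"
  unfolding dirichlet_energy_def by (simp add: sum_nonneg split_beta)

lemma energy_add_scaled:
  "energy (\<lambda>x. h x + t * k x) = energy h + 2 * t * bilinear h k + t\<^sup>2 * energy k"
proof -
  have "((h x + t * k x) - (h y + t * k y))\<^sup>2 =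
      (h x - h y)\<^sup>2 + 2 * t * ((h x - h y) * (k x - k y)) + t\<^sup>2 * (k x - k y)\<^sup>2" for x y
    by (simp add: power2_eq_square algebra_simps)
  then show ?thesis
    unfolding dirichlet_energy_def bilinear_def
    by (simp add: split_beta sum.distrib sum_distrib_left add_divide_distrib)
qed

lemma energy_scale: "energy (\<lambda>x. c * h x) = c\<^sup>2 * energy h"
proof -
  have "(c * a - c * b)\<^sup>2 = c\<^sup>2 * (a - b)\<^sup>2" for a b :: real
    by (simp add: power2_eq_square algebra_simps)
  then show ?thesis
    unfolding dirichlet_energy_def by (simp add: split_beta sum_distrib_left)
qed

lemma energy_contraction_le:
  assumes "\<And>x y. (x, y) \<in> E \<Longrightarrow> \<bar>k x - k y\<bar> \<le> \<bar>h x - h y\<bar>"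
  shows "energy k \<le> energy h"
proof -
  have "(\<Sum>(x, y)\<in>E. (k x - k y)\<^sup>2) \<le> (\<Sum>(x, y)\<in>E. (h x - h y)\<^sup>2)"
  proof (rule sum_mono)
    fix e assume e: "e \<in> E"
    obtain x y where xy: "e = (x, y)" by (cases e)
    show "(case e of (x, y) \<Rightarrow> (k x - k y)\<^sup>2) \<le> (case e of (x, y) \<Rightarrow> (h x - h y)\<^sup>2)"
      using assms[of x y] e xy by (simp add: abs_le_square_iff)
  qed
  then show ?thesis unfolding dirichlet_energy_def by simp
qed

text \<open>Clamping to \<open>[-M, M]\<close> is 1-Lipschitz. It confines minimisation to a compact
  box.\<close>

lemma energy_truncation_le:
  "energy (\<lambda>x\<in>V. max (- M) (min M (h x))) \<le> energy h"
proof (rule energy_contraction_le)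
  fix x y assume "(x, y) \<in> E"
  then have "x \<in> V" "y \<in> V" using arcs_subset by auto
  then show "\<bar>(\<lambda>x\<in>V. max (- M) (min M (h x))) x - (\<lambda>x\<in>V. max (- M) (min M (h x))) y\<bar> \<le> \<bar>h x - h y\<bar>"
    by (auto simp: max_def min_def)
qed

lemma continuous_on_energy: "continuous_on S energy"
  unfolding dirichlet_energy_def split_beta
  by (intro continuous_intros continuous_on_subset[OF continuous_on_product_coordinates]) auto

text \<open>Summation by parts: reversing every arc turns the terms with \<open>k y\<close> into
  terms with \<open>k x\<close>, and grouping arcs by their first end leaves the Laplacian.\<close>

lemma green_formula: "bilinear h k = (\<Sum>v\<in>V. k v * laplacian h v)"
proof -
  have sw: "(\<Sum>(x, y)\<in>E. (h y - h x) * k y) = (\<Sum>(x, y)\<in>E. (h x - h y) * k x)"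
    by (rule sum.reindex_bij_witness[where i = prod.swap and j = prod.swap])
      (auto intro: arcs_sym)
  have "2 * bilinear h k = (\<Sum>(x, y)\<in>E. (h x - h y) * k x + (h y - h x) * k y)"
    unfolding bilinear_def by (auto intro!: sum.cong simp: algebra_simps)
  also have "\<dots> = 2 * (\<Sum>(x, y)\<in>E. (h x - h y) * k x)"
    using sw by (simp add: split_beta sum.distrib)
  finally have "bilinear h k = (\<Sum>(x, y)\<in>E. (h x - h y) * k x)" by simp
  also have "E = Sigma V (\<lambda>x. {y. (x, y) \<in> E})"
    using arcs_subset by auto
  also have "(\<Sum>(x, y)\<in>\<dots>. (h x - h y) * k x) = (\<Sum>x\<in>V. \<Sum>y | (x, y) \<in> E. (h x - h y) * k x)"
    using finite_arcs finite_verts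
    by (intro sum.Sigma[symmetric]) (auto intro!: finite_subset[of _ V] dest: subsetD[OF arcs_subset])
  also have "\<dots> = (\<Sum>v\<in>V. k v * laplacian h v)"
    unfolding laplacian_def by (simp add: sum_distrib_left mult.commute)
  finally show ?thesis .
qed

lemma bilinear_indicator:
  assumes "v \<in> V"
  shows "bilinear h (\<lambda>x. if x = v then 1 else 0) = laplacian h v"
proof -
  have "(\<Sum>x\<in>V. (if x = v then 1 else 0) * laplacian h x) = (\<Sum>x\<in>V. if x = v then laplacian h x else 0)"
    by (intro sum.cong) auto
  then show ?thesis unfolding green_formula using finite_verts assms by simp
qed

lemma energy_eq_0_imp_constant:
  assumes "energy h = 0" "x \<in> V" "y \<in> V"
  shows "h x = h y"
proof -
  have "(\<Sum>(x, y)\<in>E. (h x - h y)\<^sup>2) = 0"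
    using assms(1) by (simp add: dirichlet_energy_def)
  then have eq: "h a = h b" if "(a, b) \<in> E" for a b
    using that finite_arcs by (subst (asm) sum_nonneg_eq_0_iff) (auto dest!: bspec)
  have "(x, y) \<in> E\<^sup>*" using connected assms by simp
  then show ?thesis by induction (auto dest: eq)
qed

lemma energy_minimizing_extension:
  obtains h where "h \<in> extensional V" "\<And>v. v \<in> L \<Longrightarrow> h v = g v"
    "\<And>k. (\<And>v. v \<in> L \<Longrightarrow> k v = g v) \<Longrightarrow> energy h \<le> energy k"
proof -
  \<comment> \<open>\<open>M\<close> bounds every leaf value, so clamping at \<open>M\<close>
    respects the boundary condition and moves every competitor into the compact set
    \<open>?S\<close>.\<close>
  define M where "M = (\<Sum>v\<in>L. \<bar>g v\<bar>)"
  have M: "\<bar>g v\<bar> \<le> M" if "v \<in> L" for v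
    unfolding M_def using that finite_leaves by (intro member_le_sum) auto
  have M0: "0 \<le> M" unfolding M_def by (simp add: sum_nonneg)
  let ?S = "(V \<rightarrow>\<^sub>E {-M..M}) \<inter> (\<Inter>v\<in>L. {h. h v = g v})"
  have cl: "closed (\<Inter>v\<in>L. {h. h v = g v})"
    by (intro closed_INT ballI closed_Collect_eq continuous_on_product_coordinates continuous_on_const)
  have trunc: "(\<lambda>x\<in>V. max (- M) (min M (k x))) \<in> ?S" if k: "\<And>v. v \<in> L \<Longrightarrow> k v = g v" for k
  proof -
    have "(\<lambda>x\<in>V. max (- M) (min M (k x))) v = g v" if v: "v \<in> L" for v
      using M[OF v] k[OF v] v leaves_subset by auto
    moreover have "(\<lambda>x\<in>V. max (- M) (min M (k x))) \<in> V \<rightarrow>\<^sub>E {-M..M}"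
      using M0 by auto
    ultimately show ?thesis by (intro IntI INT_I CollectI)
  qed
  have "\<exists>h\<in>?S. \<forall>k\<in>?S. energy h \<le> energy k"
  proof (rule continuous_attains_inf)
    show "compact ?S" using compact_PiE_Icc cl by (rule compact_Int_closed)
    have "(\<lambda>x\<in>V. max (- M) (min M (g x))) \<in> ?S" by (rule trunc) (rule refl)
    then show "?S \<noteq> {}" by (metis empty_iff)
  qed (rule continuous_on_energy)
  then obtain h where hS: "h \<in> ?S" and min: "\<forall>k\<in>?S. energy h \<le> energy k" by (rule bexE)
  note h = hS bspec[OF min]
  show thesis
  proof
    show "h \<in> extensional V" using h(1) by (auto simp: PiE_iff)
    show "h v = g v" if "v \<in> L" for v using h(1) that by auto
    show "energy h \<le> energy k" if "\<And>v. v \<in> L \<Longrightarrow> k v = g v" for k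
      by (rule order_trans[OF h(2)[OF trunc[OF that]] energy_truncation_le])
  qed
qed

text \<open>The difference of two extensions vanishes on the leaves and is harmonic elsewhere, so
  Green's formula makes its energy 0; by connectedness it is constant, with value 0 at a
  leaf.\<close>

lemma harmonic_extension_unique:
  assumes "h \<in> extensional V" "\<And>v. v \<in> L \<Longrightarrow> h v = g v"
    "\<And>v. v \<in> V - L \<Longrightarrow> laplacian h v = 0"
    and "k \<in> extensional V" "\<And>v. v \<in> L \<Longrightarrow> k v = g v"
    "\<And>v. v \<in> V - L \<Longrightarrow> laplacian k v = 0"
  shows "h = k"
proof (rule extensionalityI[OF assms(1,4)])
  fix x assume x: "x \<in> V"
  let ?d = "\<lambda>x. h x - k x"
  have lap: "laplacian ?d v = laplacian h v - laplacian k v" for v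
    by (simp add: laplacian_def sum_subtractf[symmetric] algebra_simps)
  have "energy ?d = bilinear ?d ?d"
    by (simp add: dirichlet_energy_def bilinear_def power2_eq_square)
  also have "\<dots> = 0"
    unfolding green_formula
  proof (intro sum.neutral ballI)
    fix x assume "x \<in> V"
    then show "(h x - k x) * laplacian ?d x = 0"
      using assms(2,3,5,6)[of x] by (cases "x \<in> L") (auto simp: lap)
  qed
  finally have "?d x = ?d v" if "v \<in> V" for v
    using energy_eq_0_imp_constant x that by blast
  moreover obtain v where "v \<in> L" "v \<in> V" using leaves_nonempty leaves_subset by auto
  ultimately have "h x - k x = h v - k v" by blast
  then show "h x = k x" using assms(2,5) \<open>v \<in> L\<close> by simp
qed

text \<open>Dirichlet's principle. Perturbing an energy minimiser at a non-leaf shows that it is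
  harmonic there, so by uniqueness it is the function described by \<open>THE\<close>.\<close>

lemma harmonic_extension_minimizes:
  shows harmonic_extension_leaf: "v \<in> L \<Longrightarrow> harmonic_extension G g v = g v"
    and energy_harmonic_extension_le:
      "(\<And>v. v \<in> L \<Longrightarrow> k v = g v) \<Longrightarrow> energy (harmonic_extension G g) \<le> energy k"
proof -
  obtain h where h: "h \<in> extensional V" "\<And>v. v \<in> L \<Longrightarrow> h v = g v"
    "\<And>k. (\<And>v. v \<in> L \<Longrightarrow> k v = g v) \<Longrightarrow> energy h \<le> energy k"
    by (rule energy_minimizing_extension[of g]) blast
  have lap: "laplacian h v = 0" if v: "v \<in> V - L" for v
  proof -
    let ?i = "\<lambda>x. if x = v then 1 else (0::real)"
    have "0 \<le> 2 * t * bilinear h ?i + t\<^sup>2 * energy ?i" for t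
    proof -
      have "energy h \<le> energy (\<lambda>x. h x + t * ?i x)" by (rule h(3)) (use v h(2) in auto)
      then show ?thesis by (simp add: energy_add_scaled)
    qed
    then have "bilinear h ?i = 0" by (rule linear_le_quadratic_imp_eq_0)
    then show ?thesis using v by (simp add: bilinear_indicator)
  qed
  have "harmonic_extension G g = h"
    unfolding harmonic_extension_def
  proof (rule the_equality, goal_cases)
    case 1
    show ?case using h(1,2) lap by (auto simp: laplacian_def)
  next
    case (2 k)
    then show ?case using h(1,2) lap
      by (intro harmonic_extension_unique) (auto simp: laplacian_def)
  qed
  then show "v \<in> L \<Longrightarrow> harmonic_extension G g v = g v"
    and "(\<And>v. v \<in> L \<Longrightarrow> k v = g v) \<Longrightarrow> energy (harmonic_extension G g) \<le> energy k"
    using h by auto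
qed

section \<open>Minimising the Rayleigh quotient\<close>

lemma rayleigh_minimizer:
  obtains h where "(\<Sum>v\<in>L. h v) = 0" "(\<Sum>v\<in>L. (h v)\<^sup>2) = 1"
    "\<And>k. (\<Sum>v\<in>L. k v) = 0 \<Longrightarrow> energy h * (\<Sum>v\<in>L. (k v)\<^sup>2) \<le> energy k"
proof -
  let ?S = "(V \<rightarrow>\<^sub>E {-1..1::real}) \<inter> ({h. (\<Sum>v\<in>L. h v) = 0} \<inter> {h. (\<Sum>v\<in>L. (h v)\<^sup>2) = 1})"
  have cl: "closed ({h. (\<Sum>v\<in>L. h v) = 0} \<inter> {h::'a \<Rightarrow> real. (\<Sum>v\<in>L. (h v)\<^sup>2) = 1})"
    by (intro closed_Int closed_Collect_eq continuous_on_sum continuous_on_power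
        continuous_on_product_coordinates continuous_on_const)
  \<comment> \<open>Unit norm forces leaf values into \<open>[-1, 1]\<close>, so clamping at 1 keeps
    both constraints.\<close>
  have trunc: "(\<lambda>x\<in>V. max (- 1) (min 1 (k x))) \<in> ?S"
    if k: "(\<Sum>v\<in>L. k v) = 0" "(\<Sum>v\<in>L. (k v)\<^sup>2) = 1" for k :: "'a \<Rightarrow> real"
  proof -
    let ?k = "\<lambda>x\<in>V. max (- 1) (min 1 (k x))"
    have "?k v = k v" if v: "v \<in> L" for v
    proof -
      have "(k v)\<^sup>2 \<le> (\<Sum>v\<in>L. (k v)\<^sup>2)"
        using v finite_leaves by (intro member_le_sum) auto
      then have "\<bar>k v\<bar> \<le> 1" using k by (simp add: abs_square_le_1)
      then show ?thesis using v leaves_subset by (auto simp: max_def min_def)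
    qed
    then have "(\<Sum>v\<in>L. ?k v) = 0" "(\<Sum>v\<in>L. (?k v)\<^sup>2) = 1" using k by simp_all
    moreover have "?k \<in> V \<rightarrow>\<^sub>E {-1..1}" by auto
    ultimately show ?thesis by (intro IntI CollectI)
  qed
  have norm: "\<exists>c. (\<Sum>v\<in>L. (c * k v)\<^sup>2) = 1 \<and> c\<^sup>2 * (\<Sum>v\<in>L. (k v)\<^sup>2) = 1"
    if k: "(\<Sum>v\<in>L. (k v)\<^sup>2) > 0" for k :: "'a \<Rightarrow> real"
    using k by (intro exI[of _ "1 / sqrt (\<Sum>v\<in>L. (k v)\<^sup>2)"])
      (simp add: power_mult_distrib power_divide sum_distrib_left[symmetric] sum_divide_distrib[symmetric])
  obtain a b where ab: "a \<in> L" "b \<in> L" "a \<noteq> b" using two_leaves by blast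
  \<comment> \<open>Opposite values at two leaves; after scaling, this function shows that
    \<open>?S\<close> is nonempty.\<close>
  define k where "k x = (if x = a then 1 else 0) + (if x = b then -1 else (0::real))" for x
  have k0: "(\<Sum>v\<in>L. k v) = 0" using ab finite_leaves by (simp add: k_def sum.distrib)
  have k1: "(\<Sum>v\<in>L. (k v)\<^sup>2) > 0"
    using ab finite_leaves by (intro sum_pos2[of _ a]) (auto simp: k_def)
  have "\<exists>h\<in>?S. \<forall>k\<in>?S. energy h \<le> energy k"
  proof (rule continuous_attains_inf)
    show "compact ?S" using compact_PiE_Icc cl by (rule compact_Int_closed)
    obtain c where c: "(\<Sum>v\<in>L. (c * k v)\<^sup>2) = 1" using norm[OF k1] by blast
    have "(\<Sum>v\<in>L. c * k v) = 0" using k0 by (simp add: sum_distrib_left[symmetric])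
    then have "(\<lambda>x\<in>V. max (- 1) (min 1 (c * k x))) \<in> ?S" using c by (rule trunc)
    then show "?S \<noteq> {}" by (metis empty_iff)
  qed (rule continuous_on_energy)
  then obtain h where hS: "h \<in> ?S" and min: "\<forall>k\<in>?S. energy h \<le> energy k" by (rule bexE)
  note h = hS bspec[OF min]
  show thesis
  proof
    show "(\<Sum>v\<in>L. h v) = 0" "(\<Sum>v\<in>L. (h v)\<^sup>2) = 1" using h(1) by auto
    show "energy h * (\<Sum>v\<in>L. (k v)\<^sup>2) \<le> energy k" if k: "(\<Sum>v\<in>L. k v) = 0" for k
    proof (cases "(\<Sum>v\<in>L. (k v)\<^sup>2) = 0")
      case True
      then show ?thesis by (simp add: energy_nonneg)
    next
      case False
      then have pos: "(\<Sum>v\<in>L. (k v)\<^sup>2) > 0"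
        by (simp add: sum_nonneg less_le)
      then obtain c where c: "(\<Sum>v\<in>L. (c * k v)\<^sup>2) = 1" "c\<^sup>2 * (\<Sum>v\<in>L. (k v)\<^sup>2) = 1"
        using norm by blast
      have "(\<Sum>v\<in>L. c * k v) = 0" using k by (simp add: sum_distrib_left[symmetric])
      then have "energy h \<le> energy (\<lambda>x\<in>V. max (- 1) (min 1 (c * k x)))"
        using c(1) by (intro h(2) trunc)
      also have "\<dots> \<le> energy (\<lambda>x. c * k x)" by (rule energy_truncation_le)
      also have "\<dots> = c\<^sup>2 * energy k" by (rule energy_scale)
      finally have "energy h * (\<Sum>v\<in>L. (k v)\<^sup>2) \<le> c\<^sup>2 * energy k * (\<Sum>v\<in>L. (k v)\<^sup>2)"
        using pos by (intro mult_right_mono) auto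
      also have "\<dots> = energy k * (c\<^sup>2 * (\<Sum>v\<in>L. (k v)\<^sup>2))" by simp
      finally show ?thesis using c(2) by simp
    qed
  qed
qed

text \<open>The definition ranges over harmonic extensions only. These minimise the energy for given
  leaf values, so arbitrary functions on the vertices have the same minimum; its attainment also
  justifies \<open>LEAST\<close> on the reals.\<close>

lemma steklov_lambda2_attained:
  obtains h where "(\<Sum>v\<in>L. h v) = 0" "(\<Sum>v\<in>L. (h v)\<^sup>2) = 1" "energy h = steklov_lambda2 G"
    "\<And>k. (\<Sum>v\<in>L. k v) = 0 \<Longrightarrow> steklov_lambda2 G * (\<Sum>v\<in>L. (k v)\<^sup>2) \<le> energy k"
proof -
  obtain h where h: "(\<Sum>v\<in>L. h v) = 0" "(\<Sum>v\<in>L. (h v)\<^sup>2) = 1"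
    "\<And>k. (\<Sum>v\<in>L. k v) = 0 \<Longrightarrow> energy h * (\<Sum>v\<in>L. (k v)\<^sup>2) \<le> energy k"
    by (rule rayleigh_minimizer) blast
  have ext: "energy h * (\<Sum>v\<in>L. (g v)\<^sup>2) \<le> energy (harmonic_extension G g)"
    if "(\<Sum>v\<in>L. g v) = 0" for g
    using h(3)[of "harmonic_extension G g"] that by (simp add: harmonic_extension_leaf)
  have "steklov_lambda2 G = energy h"
    unfolding steklov_lambda2_def
  proof (rule Least_equality, goal_cases)
    case 1
    have "energy (harmonic_extension G h) = energy h"
      using ext[OF h(1)] h(2) energy_harmonic_extension_le[of h h] by simp
    moreover have "\<exists>v\<in>L. h v \<noteq> 0"
    proof (rule ccontr)
      assume "\<not> ?thesis"
      then have "(\<Sum>v\<in>L. (h v)\<^sup>2) = 0" by (intro sum.neutral) auto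
      then show False using h(2) by simp
    qed
    ultimately show ?case using h by (intro exI[of _ h]) simp
  next
    case (2 l)
    then obtain g v where g: "v \<in> L" "g v \<noteq> 0" "(\<Sum>v\<in>L. g v) = 0"
      "l = energy (harmonic_extension G g) / (\<Sum>v\<in>L. (g v)\<^sup>2)" by blast
    have "(\<Sum>v\<in>L. (g v)\<^sup>2) > 0"
      using g finite_leaves by (intro sum_pos2[of _ v]) auto
    then show ?case using ext[OF g(3)] g(4) by (simp add: pos_le_divide_eq)
  qed
  then show thesis using h that by force
qed

lemma steklov_lambda2_pos: "0 < steklov_lambda2 G"
proof -
  obtain h where h: "(\<Sum>v\<in>L. h v) = 0" "(\<Sum>v\<in>L. (h v)\<^sup>2) = 1" "energy h = steklov_lambda2 G"
    by (rule steklov_lambda2_attained)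
  have "energy h \<noteq> 0"
  proof
    assume "energy h = 0"
    then have const: "h x = h y" if "x \<in> L" "y \<in> L" for x y
      using energy_eq_0_imp_constant leaves_subset that by blast
    obtain a where a: "a \<in> L" using leaves_nonempty by auto
    have "(\<Sum>v\<in>L. h v) = (\<Sum>v\<in>L. h a)" by (rule sum.cong) (auto intro: const a)
    then have "h a = 0" using h(1) a finite_leaves by auto
    then have "(\<Sum>v\<in>L. (h v)\<^sup>2) = 0" using const[OF _ a] by (intro sum.neutral) auto
    then show False using h(2) by simp
  qed
  then show ?thesis using energy_nonneg[of h] h(3) by simp
qed

text \<open>Subtracting the leaf mean changes no increment, so test functions need not have leaf sum
  zero.\<close>

lemma steklov_lambda2_le:
  "steklov_lambda2 G * ((\<Sum>v\<in>L. (k v)\<^sup>2) - (\<Sum>v\<in>L. k v)\<^sup>2 / card L) \<le> energy k"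
proof -
  define m where "m = (\<Sum>v\<in>L. k v) / card L"
  have c: "real (card L) > 0" using finite_leaves leaves_nonempty by (simp add: card_gt_0_iff)
  have "(\<Sum>v\<in>L. k v - m) = 0" using c by (simp add: sum_subtractf m_def)
  then have "steklov_lambda2 G * (\<Sum>v\<in>L. (k v - m)\<^sup>2) \<le> energy (\<lambda>x. k x - m)"
    using steklov_lambda2_attained by metis
  moreover have "energy (\<lambda>x. k x - m) = energy k"
    by (simp add: dirichlet_energy_def)
  ultimately show ?thesis
    using sum_power2_diff_mean[OF finite_leaves leaves_nonempty, of k] by (simp add: m_def)
qed

text \<open>The Euler-Lagrange equation: the minimiser is perturbed at a single vertex. This may
  spoil the zero sum on the leaves, so the variance form of the inequality is the one to
  expand.\<close>

lemma steklov_eigenfunction: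
  obtains h where "(\<Sum>v\<in>L. h v) = 0" "(\<Sum>v\<in>L. (h v)\<^sup>2) = 1" "energy h = steklov_lambda2 G"
    "\<And>v. v \<in> V \<Longrightarrow> laplacian h v = (if v \<in> L then steklov_lambda2 G * h v else 0)"
proof -
  let ?l = "steklov_lambda2 G"
  obtain h where h: "(\<Sum>v\<in>L. h v) = 0" "(\<Sum>v\<in>L. (h v)\<^sup>2) = 1" "energy h = ?l"
    by (rule steklov_lambda2_attained)
  have "laplacian h v = (if v \<in> L then ?l * h v else 0)" if v: "v \<in> V" for v
  proof -
    let ?i = "\<lambda>x. if x = v then 1 else (0::real)"
    let ?h = "if v \<in> L then h v else 0"
    let ?n = "if v \<in> L then 1 else (0::real)"
    \<comment> \<open>\<open>?n - ?n / card L\<close> is the sum of squared deviations of the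
      indicator on the leaves.\<close>
    have "0 \<le> 2 * t * (bilinear h ?i - ?l * ?h) + t\<^sup>2 * (energy ?i - ?l * (?n - ?n / card L))" for t
    proof -
      have s: "(\<Sum>x\<in>L. ?i x) = ?n" "(\<Sum>x\<in>L. h x * ?i x) = ?h" "(\<Sum>x\<in>L. (?i x)\<^sup>2) = ?n"
        using finite_leaves by (auto simp: if_distrib[of "\<lambda>x. x\<^sup>2"] if_distrib[of "\<lambda>x. a * x" for a] sum.delta cong: if_cong)
      have "(\<Sum>x\<in>L. (h x + t * ?i x)\<^sup>2) =
          (\<Sum>x\<in>L. (h x)\<^sup>2) + 2 * t * (\<Sum>x\<in>L. h x * ?i x) + t\<^sup>2 * (\<Sum>x\<in>L. (?i x)\<^sup>2)"
        by (simp only: sum_distrib_left sum.distrib[symmetric])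
          (intro sum.cong, auto simp: power2_eq_square algebra_simps)
      moreover have "(\<Sum>x\<in>L. h x + t * ?i x) = (\<Sum>x\<in>L. h x) + t * (\<Sum>x\<in>L. ?i x)"
        by (simp only: sum_distrib_left sum.distrib)
      moreover have "(t * ?n)\<^sup>2 = t\<^sup>2 * ?n" by simp
      ultimately have "?l * (1 + 2 * t * ?h + t\<^sup>2 * ?n - t\<^sup>2 * ?n / card L)
          \<le> ?l + 2 * t * bilinear h ?i + t\<^sup>2 * energy ?i"
        using steklov_lambda2_le[of "\<lambda>x. h x + t * ?i x"] h s
        by (simp only: energy_add_scaled) simp
      then show ?thesis by (simp add: algebra_simps)
    qed
    then have "bilinear h ?i - ?l * ?h = 0" by (rule linear_le_quadratic_imp_eq_0)
    then show ?thesis using bilinear_indicator[OF v] by auto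
  qed
  then show thesis using that h by blast
qed

end

section \<open>Trees rooted at an edge\<close>

lemma relpow_imp_walk:
  assumes "pair_wf_digraph G" "x \<in> pverts G" "(x, y) \<in> parcs G ^^ k"
  shows "\<exists>p. pre_digraph.awalk (with_proj G) x p y \<and> length p = k"
proof -
  interpret pair_wf_digraph G by fact
  from assms(2,3) show ?thesis
  proof (induction k arbitrary: x)
    case 0
    then show ?case by (auto simp: awalk_Nil_iff)
  next
    case (Suc k)
    then obtain z where z: "(x, z) \<in> parcs G" "(z, y) \<in> parcs G ^^ k"
      by (metis relpow_Suc_D2)
    then obtain p where "awalk z p y" "length p = k"
      using Suc.IH in_arcsD2 by blast
    then have "awalk x ((x, z) # p) y" using z Suc.prems by (simp add: awalk_Cons_iff)
    then show ?case using \<open>length p = k\<close> by force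
  qed
qed

lemma walk_imp_relpow:
  assumes "pair_wf_digraph G" "pre_digraph.awalk (with_proj G) x p y"
  shows "(x, y) \<in> parcs G ^^ length p"
proof -
  interpret pair_wf_digraph G by fact
  from assms(2) show ?thesis
  proof (induction p arbitrary: x)
    case Nil
    then show ?case by (auto simp: awalk_Nil_iff)
  next
    case (Cons e p)
    then have e: "e \<in> parcs G" "fst e = x" "awalk (snd e) p y"
      by (auto simp: awalk_Cons_iff)
    then have "(x, snd e) \<in> parcs G" by auto
    then show ?case using relpow_Suc_I2[OF _ Cons.IH[OF e(3)]] by simp
  qed
qed

lemma (in wf_digraph) unit_awalk_cost: "awalk_cost (\<lambda>_. 1) p = length p"
  by (simp add: awalk_cost_def map_replicate_const sum_list_replicate)

lemma graph_diameter_eqI: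
  assumes wf: "pair_wf_digraph G"
    and le: "\<And>x y. x \<in> pverts G \<Longrightarrow> y \<in> pverts G \<Longrightarrow> \<exists>k\<le>m. (x, y) \<in> parcs G ^^ k"
    and a: "a \<in> pverts G" and b: "b \<in> pverts G"
    and ge: "\<And>k. (a, b) \<in> parcs G ^^ k \<Longrightarrow> m \<le> k"
  shows "graph_diameter G = ereal (real m)"
proof -
  interpret pair_wf_digraph G by fact
  have "\<mu> (\<lambda>_. 1) x y \<le> ereal (real m)" if xy: "x \<in> pverts G" "y \<in> pverts G" for x y
  proof -
    obtain k where "k \<le> m" "(x, y) \<in> parcs G ^^ k" using le[OF xy] by blast
    then obtain p where "awalk x p y" "length p \<le> m"
      using relpow_imp_walk[OF wf xy(1)] by blast
    then show ?thesis
      using min_cost_le_walk_cost[of x p y "\<lambda>_. 1"]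
      by (auto simp: unit_awalk_cost intro: order_trans)
  qed
  moreover have "ereal (real m) \<le> \<mu> (\<lambda>_. 1) a b"
    unfolding \<mu>_def using ge walk_imp_relpow[OF wf]
    by (intro INF_greatest) (auto simp: unit_awalk_cost)
  ultimately show ?thesis
    unfolding graph_diameter_def
    by (intro antisym SUP_least SUP_upper2[OF a SUP_upper2[OF b]])
qed

lemma graph_diameter_eqD:
  assumes wf: "pair_wf_digraph G" and diam: "graph_diameter G = ereal (real m)" and "1 \<le> m"
  shows graph_diameter_walk_le:
      "x \<in> pverts G \<Longrightarrow> y \<in> pverts G \<Longrightarrow> \<exists>k\<le>m. (x, y) \<in> parcs G ^^ k"
    and graph_diameter_attained:
      "\<exists>x\<in>pverts G. \<exists>y\<in>pverts G. \<forall>k. (x, y) \<in> parcs G ^^ k \<longrightarrow> m \<le> k"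
proof -
  interpret pair_wf_digraph G by fact
  show "\<exists>k\<le>m. (x, y) \<in> parcs G ^^ k" if xy: "x \<in> pverts G" "y \<in> pverts G"
  proof (rule ccontr)
    assume "\<not> ?thesis"
    then have *: "Suc m \<le> k" if "(x, y) \<in> parcs G ^^ k" for k
      using that by (meson not_less_eq_eq)
    have "ereal (real (Suc m)) \<le> \<mu> (\<lambda>_. 1) x y"
      unfolding \<mu>_def using * walk_imp_relpow[OF wf]
      by (intro INF_greatest) (auto simp only: unit_awalk_cost mem_Collect_eq ereal_less_eq of_nat_le_iff)
    also have "\<dots> \<le> graph_diameter G"
      unfolding graph_diameter_def by (intro SUP_upper2[OF xy(1) SUP_upper2[OF xy(2)]] order_refl)
    finally show False using diam by simp
  qed
  show "\<exists>x\<in>pverts G. \<exists>y\<in>pverts G. \<forall>k. (x, y) \<in> parcs G ^^ k \<longrightarrow> m \<le> k"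
  proof (rule ccontr)
    assume "\<not> ?thesis"
    then have *: "\<exists>k<m. (x, y) \<in> parcs G ^^ k" if "x \<in> pverts G" "y \<in> pverts G" for x y
      using that by (meson not_le)
    \<comment> \<open>A strict bound by \<open>m\<close> could be lost in the supremum; distances
      being integers, it becomes \<open>m - 1\<close>.\<close>
    have "\<mu> (\<lambda>_. 1) x y \<le> ereal (real (m - 1))" if xy: "x \<in> pverts G" "y \<in> pverts G" for x y
    proof -
      obtain k where "k < m" "(x, y) \<in> parcs G ^^ k" using * xy by blast
      then obtain p where "awalk x p y" "length p \<le> m - 1"
        using relpow_imp_walk[OF wf xy(1)] by (metis Suc_pred' gr_implies_not_zero less_Suc_eq_le neq0_conv)
      then show ?thesis
        using min_cost_le_walk_cost[of x p y "\<lambda>_. 1"]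
        by (auto simp: unit_awalk_cost intro: order_trans)
    qed
    then have "graph_diameter G \<le> ereal (real (m - 1))"
      unfolding graph_diameter_def by (intro SUP_least)
    then show False using diam \<open>1 \<le> m\<close> by simp
  qed
qed

section \<open>Connectedness and bridges of trees\<close>

lemma tree_graph_connected:
  assumes "tree_graph G" "x \<in> pverts G" "y \<in> pverts G"
  shows "(x, y) \<in> (parcs G)\<^sup>*"
proof -
  interpret pair_graph G using assms by (simp add: tree_graph_def)
  have "x \<rightarrow>\<^sup>*\<^bsub>with_proj (mk_symmetric (with_proj G))\<^esub> y"
    using assms by (simp add: tree_graph_def connected_def strongly_connected_def)
  then have "(x, y) \<in> rtrancl_on (pverts G) (parcs (mk_symmetric (with_proj G)))"
    by (simp add: reachable_def)
  then show ?thesis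
  proof (induction rule: rtrancl_on_induct)
    case (step y z)
    then have "(y, z) \<in> parcs G" by (auto simp: parcs_mk_symmetric intro: arcs_symmetric)
    with step show ?case by (auto intro: rtrancl_into_rtrancl)
  qed auto
qed

text \<open>A simple path from \<open>x\<close> to \<open>y\<close> that avoids the edge would close
  up with it to a cycle. The path has at least two arcs, so the cycle is not merely an edge walked
  to and fro.\<close>

lemma tree_graph_bridge:
  assumes tree: "tree_graph G" and xy: "(x, y) \<in> parcs G"
  shows "(x, y) \<notin> (parcs G - {(x, y), (y, x)})\<^sup>*"
proof
  interpret pair_graph G using tree by (simp add: tree_graph_def)
  let ?F = "parcs G - {(x, y), (y, x)}"
  \<comment> \<open>Deleting the edge in a graph of its own lets a walk be shortened to a simple
    path that still avoids the edge.\<close>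
  define H where "H = G\<lparr>parcs := ?F\<rparr>"
  interpret H: pair_wf_digraph H
    by unfold_locales (auto simp: H_def dest: wellformed')
  assume "(x, y) \<in> ?F\<^sup>*"
  then obtain k where "(x, y) \<in> parcs H ^^ k" by (auto simp: H_def rtrancl_is_UN_relpow)
  moreover have "x \<in> pverts H" using xy in_arcsD1 by (auto simp: H_def)
  ultimately obtain q where "H.awalk x q y"
    using relpow_imp_walk[OF H.pair_wf_digraph_axioms] by blast
  then have "x \<rightarrow>\<^sup>*\<^bsub>with_proj H\<^esub> y" by (rule H.reachable_awalkI)
  then obtain p where p: "H.apath x p y" unfolding H.reachable_apath by blast
  have neq: "x \<noteq> y" using xy no_loops' by blast
  have awalk: "awalk x p y" and dist: "distinct (awalk_verts x p)"
    and sub: "set p \<subseteq> ?F"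
  proof -
    have "H.awalk x p y" "distinct (H.awalk_verts x p)" using p by (simp_all add: H.apath_def)
    then show "awalk x p y" "distinct (awalk_verts x p)" "set p \<subseteq> ?F"
      by (auto simp: H.awalk_def awalk_def) (auto simp: H_def)
  qed
  have "2 \<le> length p"
  proof (rule ccontr)
    assume "\<not> 2 \<le> length p"
    then consider "p = []" | e where "p = [e]" by (cases p rule: remdups_adj.cases) auto
    then show False
    proof cases
      case 1 then show False using awalk neq by (simp add: awalk_Nil_iff)
    next
      case (2 e)
      then have "e = (x, y)" using awalk by (auto simp: awalk_simps prod_eq_iff)
      then show False using sub 2 by auto
    qed
  qed
  let ?c = "p @ [(y, x)]"
  have yx: "(y, x) \<in> parcs G" using xy arcs_symmetric by blast
  have walk: "awalk x ?c x"
    using awalk yx by (auto simp: awalk_simps dest: in_arcsD2 in_arcsD1)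
  have last: "awlast x p = y" using awalk by simp
  have "awalk_verts x ?c = awalk_verts x p @ [x]"
    using awalk_verts_append[OF walk] last by simp
  moreover obtain vs where vs: "awalk_verts x p = x # vs"
    using awhd_of_awalk[OF awalk] by (metis awalk_verts_non_Nil list.collapse)
  ultimately have "distinct (tl (awalk_verts x ?c))" using dist by auto
  with walk have "cycle ?c" by (auto simp: cycle_def)
  then show False using tree \<open>2 \<le> length p\<close> unfolding tree_graph_def by force
qed

text \<open>\<open>par\<close> is arbitrary at the two roots \<open>u\<close> and \<open>v\<close>.\<close>

locale hub_tree =
  fixes G :: "'a pair_pre_digraph" and u v :: 'a
    and par :: "'a \<Rightarrow> 'a" and dep :: "'a \<Rightarrow> nat" and side :: "'a \<Rightarrow> bool"
  assumes finite_verts: "finite (pverts G)"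
    and hub_in_verts: "u \<in> pverts G" "v \<in> pverts G"
    and dep_hub: "dep u = 0" "dep v = 0"
    and side_hub: "side u" "\<not> side v"
    and par_in_verts: "\<And>w. w \<in> pverts G - {u, v} \<Longrightarrow> par w \<in> pverts G"
    and dep_par: "\<And>w. w \<in> pverts G - {u, v} \<Longrightarrow> dep w = Suc (dep (par w))"
    and side_par: "\<And>w. w \<in> pverts G - {u, v} \<Longrightarrow> side (par w) = side w"
    and arcs_eq: "parcs G = {(u, v), (v, u)} \<union> (\<lambda>w. (w, par w)) ` (pverts G - {u, v})
      \<union> (\<lambda>w. (par w, w)) ` (pverts G - {u, v})"
begin

abbreviation "V \<equiv> pverts G"
abbreviation "E \<equiv> parcs G"
abbreviation "N \<equiv> pverts G - {u, v}"

definition hub :: "bool \<Rightarrow> 'a" where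
  "hub s = (if s then u else v)"

lemma hubs_neq: "u \<noteq> v"
  using side_hub by auto

lemma hub_simps [simp]: "hub s \<in> V" "dep (hub s) = 0" "side (hub s) = s"
  using hub_in_verts dep_hub side_hub by (auto simp: hub_def)

lemma in_N_iff: "w \<in> N \<longleftrightarrow> w \<in> V \<and> 0 < dep w"
proof (cases "w = u \<or> w = v")
  case False
  then show ?thesis using dep_par[of w] by auto
qed (auto simp: dep_hub)

lemma in_V_cases:
  assumes "w \<in> V"
  obtains "w \<in> N" | "w = hub (side w)"
  using assms side_hub by (cases "w \<in> N") (auto simp: hub_def)

lemma arcs_subset: "E \<subseteq> V \<times> V"
  using hub_in_verts par_in_verts by (subst arcs_eq) auto

lemma arcs_sym: "(x, y) \<in> E \<Longrightarrow> (y, x) \<in> E"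
  by (subst (asm) arcs_eq, subst arcs_eq) auto

lemma par_arc: "w \<in> N \<Longrightarrow> (w, par w) \<in> E" "w \<in> N \<Longrightarrow> (par w, w) \<in> E"
  by (subst arcs_eq, auto)+

lemma neighbours_eq:
  assumes "w \<in> N"
  shows "{z. (w, z) \<in> E} = insert (par w) {z \<in> N. par z = w}"
    and "par w \<notin> {z \<in> N. par z = w}"
proof -
  show "{z. (w, z) \<in> E} = insert (par w) {z \<in> N. par z = w}"
    using assms by (subst arcs_eq) auto
  show "par w \<notin> {z \<in> N. par z = w}"
    using dep_par[of w] dep_par[of "par w"] assms by auto
qed

lemma wf: "pair_wf_digraph G"
  using arcs_subset by unfold_locales auto

lemma energy_eq:
  "dirichlet_energy G f = (f u - f v)\<^sup>2 + (\<Sum>w\<in>N. (f w - f (par w))\<^sup>2)"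
proof -
  let ?A = "(\<lambda>w. (w, par w)) ` N" and ?B = "(\<lambda>w. (par w, w)) ` N"
  let ?g = "\<lambda>(x, y). (f x - f y)\<^sup>2"
  have disj: "?A \<inter> ?B = {}" "{(u, v), (v, u)} \<inter> (?A \<union> ?B) = {}"
  proof -
    have "par w \<noteq> z \<or> w \<noteq> par z" if "w \<in> N" "z \<in> N" for w z
      using dep_par[OF that(1)] dep_par[OF that(2)] by auto
    then show "?A \<inter> ?B = {}" by blast
  qed auto
  have fin: "finite ?A" "finite ?B" using finite_verts by auto
  have "sum ?g E = sum ?g {(u, v), (v, u)} + (sum ?g ?A + sum ?g ?B)"
    using disj fin
    by (simp only: arcs_eq Un_assoc sum.union_disjoint finite_Un finite.intros)
  also have "sum ?g ?A = (\<Sum>w\<in>N. (f w - f (par w))\<^sup>2)"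
    by (subst sum.reindex) (auto simp: inj_on_def)
  also have "sum ?g ?B = (\<Sum>w\<in>N. (f w - f (par w))\<^sup>2)"
    by (subst sum.reindex) (auto simp: inj_on_def power2_commute)
  also have "sum ?g {(u, v), (v, u)} = 2 * (f u - f v)\<^sup>2"
    using hubs_neq by (simp add: power2_commute)
  finally show ?thesis by (simp add: dirichlet_energy_def)
qed

lemma walk_to_hub: "w \<in> V \<Longrightarrow> (w, hub (side w)) \<in> E ^^ dep w"
proof (induction "dep w" arbitrary: w)
  case 0
  then have "w \<notin> N" unfolding in_N_iff by simp
  then have "hub (side w) = w" using in_V_cases[OF 0(2)] by metis
  then show ?case using 0(1) by (metis relpow_0_I)
next
  case (Suc k)
  then have w: "w \<in> N" unfolding in_N_iff by simp
  then have "k = dep (par w)" using dep_par Suc by simp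
  then have "(par w, hub (side w)) \<in> E ^^ k"
    using Suc(1)[of "par w"] w par_in_verts side_par by simp
  then show ?case using relpow_Suc_I2[OF par_arc(1)[OF w]] by (simp only: Suc(2)[symmetric])
qed

lemma sym_relpow: "(x, y) \<in> E ^^ k \<Longrightarrow> (y, x) \<in> E ^^ k"
proof (induction k arbitrary: y)
  case (Suc k)
  then obtain z where "(x, z) \<in> E ^^ k" "(z, y) \<in> E" by auto
  then show ?case using Suc.IH relpow_Suc_I2 arcs_sym by metis
qed simp

lemma hub_hub: "(hub s, hub (\<not> s)) \<in> E"
  by (subst arcs_eq) (auto simp: hub_def)

lemma walk_same_side:
  assumes "x \<in> V" "y \<in> V" "side x = side y"
  shows "(x, y) \<in> E ^^ (dep x + dep y)"
  using walk_to_hub[OF assms(1)] sym_relpow[OF walk_to_hub[OF assms(2)]] assms(3)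
  by (auto simp: relpow_add)

lemma walk_opposite_side:
  assumes "x \<in> V" "y \<in> V" "side x \<noteq> side y"
  shows "(x, y) \<in> E ^^ (dep x + dep y + 1)"
proof -
  have "(hub (side x), y) \<in> E ^^ Suc (dep y)"
  proof (rule relpow_Suc_I2[OF hub_hub])
    have "(\<not> side x) = side y" using assms(3) by auto
    then show "(hub (\<not> side x), y) \<in> E ^^ dep y"
      using sym_relpow[OF walk_to_hub[OF assms(2)]] by simp
  qed
  then have "(x, y) \<in> E ^^ (dep x + Suc (dep y))"
    unfolding relpow_add by (rule relcompI[OF walk_to_hub[OF assms(1)]])
  then show ?thesis by simp
qed

lemma connected: "x \<in> V \<Longrightarrow> y \<in> V \<Longrightarrow> (x, y) \<in> E\<^sup>*"
  using walk_same_side walk_opposite_side relpow_imp_rtrancl by metis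

text \<open>A function that changes by at most 1 along every arc, so that it bounds distances from below.\<close>

definition pos :: "'a \<Rightarrow> int" where
  "pos w = (if side w then - int (dep w) else 1 + int (dep w))"

lemma pos_walk: "(x, y) \<in> E ^^ k \<Longrightarrow> \<bar>pos x - pos y\<bar> \<le> int k"
proof (induction k arbitrary: y)
  case (Suc k)
  then obtain z where "(x, z) \<in> E ^^ k" "(z, y) \<in> E" by auto
  moreover have "\<bar>pos z - pos y\<bar> \<le> 1"
    using \<open>(z, y) \<in> E\<close> dep_par side_par dep_hub side_hub
    by (subst (asm) arcs_eq) (auto simp: pos_def)
  ultimately show ?case using Suc.IH[of z] by simp
qed simp

text \<open>Between opposite sides \<open>pos\<close> differs by exactly
  \<open>dep x + dep y + 1\<close>, so the walk through both hubs is shortest.\<close>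

lemma walk_opposite_side_ge:
  assumes "(x, y) \<in> E ^^ k" "side x \<noteq> side y"
  shows "dep x + dep y + 1 \<le> k"
  using pos_walk[OF assms(1)] assms(2) by (auto simp: pos_def split: if_splits)

end

text \<open>Diameter \<open>2 * r + 1\<close> in the form in which it is used: the hubs are the ends
  of the central edge. Both \<open>T\<close> and \<open>D\<close> are instances.\<close>

locale deep_hub_tree = hub_tree +
  fixes r :: nat
  assumes r_pos: "1 \<le> r"
    and dep_le: "\<And>w. w \<in> pverts G \<Longrightarrow> dep w \<le> r"
    and dep_attained: "\<And>s. \<exists>w\<in>pverts G. side w = s \<and> dep w = r"
begin

lemma graph_diameter: "graph_diameter G = ereal (real (2 * r + 1))"
proof -
  obtain a b where ab: "a \<in> V" "side a" "dep a = r" "b \<in> V" "\<not> side b" "dep b = r"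
    using dep_attained by metis
  show ?thesis
  proof (rule graph_diameter_eqI[OF wf _ ab(1,4)])
    fix x y assume xy: "x \<in> V" "y \<in> V"
    then show "\<exists>k\<le>2 * r + 1. (x, y) \<in> E ^^ k"
      using walk_same_side[OF xy] walk_opposite_side[OF xy] dep_le[of x] dep_le[of y]
      by (cases "side x = side y") (force intro: exI[of _ "dep x + dep y"] exI[of _ "dep x + dep y + 1"])+
  next
    fix k assume "(a, b) \<in> E ^^ k"
    then show "2 * r + 1 \<le> k" using walk_opposite_side_ge[of a b k] ab by simp
  qed
qed

text \<open>Keeps the hubs out of the leaf set: each has a neighbour besides the opposite
  hub.\<close>

lemma hub_child: "\<exists>w\<in>N. par w = hub s"
proof -
  have "\<exists>w\<in>N. par w = hub s" if "w \<in> N" "side w = s" for w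
    using that
  proof (induction "dep w" arbitrary: w)
    case 0
    then show ?case using in_N_iff[of w] by simp
  next
    case (Suc k)
    have p: "par w \<in> V" "side (par w) = s" "dep (par w) = k"
      using Suc par_in_verts[of w] side_par[of w] dep_par[of w] by auto
    then show ?case using Suc by (cases rule: in_V_cases[OF p(1)]) auto
  qed
  moreover obtain w where "w \<in> V" "side w = s" "dep w = r" using dep_attained by blast
  moreover have "w \<in> N" using calculation r_pos unfolding in_N_iff by simp
  ultimately show ?thesis by blast
qed

lemma leaves_eq: "leaves G = {w \<in> N. \<forall>z\<in>N. par z \<noteq> w}"
proof -
  have out: "out_degree (with_proj G) w = card {z. (w, z) \<in> E}" for w
  proof -
    have "out_arcs (with_proj G) w = Pair w ` {z. (w, z) \<in> E}"
      by (auto simp: out_arcs_def)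
    then show ?thesis by (simp add: out_degree_def card_image inj_on_def)
  qed
  have fin: "finite {z. (w, z) \<in> E}" for w
    by (rule finite_subset[OF _ finite_verts]) (use arcs_subset in auto)
  have "out_degree (with_proj G) w \<noteq> 1" if w: "w = hub s" for w s
  proof
    assume "out_degree (with_proj G) w = 1"
    then obtain a where a: "{z. (w, z) \<in> E} = {a}" by (auto simp: out card_1_singleton_iff)
    obtain z where z: "z \<in> N" "par z = w" using hub_child w by blast
    then have "(w, z) \<in> E" using par_arc by blast
    moreover have "(w, hub (\<not> s)) \<in> E" using hub_hub w by simp
    ultimately have "z = hub (\<not> s)" using a by (metis mem_Collect_eq singletonD)
    then show False using z by (simp add: hub_def split: if_splits)
  qed
  then have "u \<notin> leaves G" "v \<notin> leaves G"
    unfolding leaves_def hub_def by (metis (mono_tags) mem_Collect_eq)+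
  moreover have "w \<in> leaves G \<longleftrightarrow> (\<forall>z\<in>N. par z \<noteq> w)" if w: "w \<in> N" for w
  proof -
    have "finite {z \<in> N. par z = w}" using finite_verts by simp
    then have "out_degree (with_proj G) w = Suc (card {z \<in> N. par z = w})"
      unfolding out neighbours_eq(1)[OF w] using neighbours_eq(2)[OF w] by simp
    then show ?thesis using w finite_verts by (auto simp: leaves_def)
  qed
  moreover have "leaves G \<subseteq> V" by (auto simp: leaves_def)
  ultimately show ?thesis by auto
qed

lemma deepest_leaf: "w \<in> V \<Longrightarrow> dep w = r \<Longrightarrow> w \<in> leaves G"
  unfolding leaves_eq using r_pos in_N_iff dep_par dep_le by (fastforce simp: Suc_le_eq)

sublocale steklov: boundary_graph G
proof
  obtain a b where "a \<in> V" "side a" "dep a = r" "b \<in> V" "\<not> side b" "dep b = r"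
    using dep_attained by metis
  then show "\<exists>x\<in>leaves G. \<exists>y\<in>leaves G. x \<noteq> y" using deepest_leaf by metis
qed (use finite_verts arcs_subset arcs_sym connected in auto)

end

section \<open>Rooting a tree at its central edge\<close>

lemma tree_graph_imp_hub_tree:
  assumes tree: "tree_graph G" and uv: "(u, v) \<in> parcs G"
  shows "\<exists>par dep side. hub_tree G u v par dep side"
proof -
  interpret pair_graph G using tree by (simp add: tree_graph_def)
  let ?V = "pverts G" and ?E = "parcs G"
  \<comment> \<open>Without the edge \<open>uv\<close> the tree falls into two components:
    \<open>side\<close> marks that of \<open>u\<close>, and \<open>dep\<close> is the distance in
    \<open>F\<close> from the root of the own component.\<close>
  define F where "F = ?E - {(u, v), (v, u)}"
  have symF: "sym F" using arcs_symmetric by (auto simp: F_def sym_def)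
  have FV: "a \<in> ?V" "b \<in> ?V" if "(a, b) \<in> F" for a b
    using that in_arcsD1 in_arcsD2 by (auto simp: F_def)
  have uV: "u \<in> ?V" "v \<in> ?V" using uv in_arcsD1 in_arcsD2 by auto
  define side where "side w \<longleftrightarrow> (u, w) \<in> F\<^sup>*" for w
  define root where "root s = (if s then u else v)" for s
  define dep where "dep w = (LEAST k. (root (side w), w) \<in> F ^^ k)" for w
  have side_u: "side u" by (simp add: side_def)
  have side_v: "\<not> side v" using tree_graph_bridge[OF tree uv] by (simp add: side_def F_def)
  have "(u, w) \<in> F\<^sup>* \<or> (v, w) \<in> F\<^sup>*" if "w \<in> ?V" for w
  proof -
    have "(u, w) \<in> ?E\<^sup>*" using tree_graph_connected[OF tree] uV that by blast
    then show ?thesis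
    proof induction
      case (step y z)
      show ?case
      proof (cases "(y, z) \<in> F")
        case True
        then show ?thesis using step by (meson rtrancl_into_rtrancl)
      next
        case False
        then have "z = u \<or> z = v" using step by (auto simp: F_def)
        then show ?thesis by auto
      qed
    qed simp
  qed
  then have reach: "(root (side w), w) \<in> F\<^sup>*" if "w \<in> ?V" for w
    using that by (auto simp: root_def side_def)
  have dep: "(root (side w), w) \<in> F ^^ dep w" if "w \<in> ?V" for w
  proof -
    have "\<exists>k. (root (side w), w) \<in> F ^^ k"
      using reach[OF that] by (simp add: rtrancl_is_UN_relpow)
    then show ?thesis unfolding dep_def by (rule LeastI_ex)
  qed
  have dep_least: "dep w \<le> k" if "(root (side w), w) \<in> F ^^ k" for w k
    unfolding dep_def using that by (rule Least_le)
  have sideF: "side a = side b" if "(a, b) \<in> F" for a b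
    using that symD[OF symF that] unfolding side_def by (meson rtrancl_into_rtrancl)
  \<comment> \<open>The parent is the last but one vertex of a shortest walk from the root.\<close>
  have "\<exists>z. (z, w) \<in> F \<and> dep w = Suc (dep z)" if w: "w \<in> ?V - {u, v}" for w
  proof -
    have "dep w \<noteq> 0"
      using dep[of w] w by (intro notI) (auto simp: root_def split: if_splits)
    then obtain k where k: "dep w = Suc k" by (cases "dep w") auto
    then obtain z where z: "(root (side w), z) \<in> F ^^ k" "(z, w) \<in> F"
      using dep[of w] w by auto
    have "dep z \<le> k" using z sideF[OF z(2)] by (intro dep_least) simp
    moreover have "dep w \<le> Suc (dep z)"
      using dep[of z] FV[OF z(2)] z sideF[OF z(2)] by (intro dep_least) (auto intro: relcompI)
    ultimately show ?thesis using z k by auto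
  qed
  then obtain par where par: "\<And>w. w \<in> ?V - {u, v} \<Longrightarrow> (par w, w) \<in> F \<and> dep w = Suc (dep (par w))"
    by metis
  \<comment> \<open>Otherwise the parent chains would join \<open>a\<close> to \<open>b\<close> without using the bridge \<open>ab\<close>.\<close>
  have arcs: "(a \<in> ?V - {u, v} \<and> b = par a) \<or> (b \<in> ?V - {u, v} \<and> a = par b)" if ab: "(a, b) \<in> F" for a b
  proof (rule ccontr)
    assume neg: "\<not> ?thesis"
    let ?K = "?E - {(a, b), (b, a)}"
    have symK: "sym (?K\<^sup>*)" using arcs_symmetric by (intro sym_rtrancl) (auto simp: sym_def)
    have K: "(w, root (side w)) \<in> ?K\<^sup>*" if "w \<in> ?V" for w
      using that
    proof (induction "dep w" arbitrary: w)
      case 0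
      then show ?case using dep[of w] by auto
    next
      case (Suc k)
      have "w \<noteq> u" "w \<noteq> v"
        using Suc(2) dep_least[of u 0] dep_least[of v 0] side_u side_v by (auto simp: root_def)
      then have w: "w \<in> ?V - {u, v}" using Suc by simp
      note p = par[OF w]
      have "(par w, w) \<in> ?E" using p by (simp add: F_def)
      then have "(w, par w) \<in> ?K" using neg w arcs_symmetric by auto
      moreover have "(par w, root (side w)) \<in> ?K\<^sup>*"
        using Suc(1)[of "par w"] Suc(2) p sideF[of "par w" w] FV[of "par w" w] by simp
      ultimately show ?case by (rule converse_rtrancl_into_rtrancl)
    qed
    have "(a, b) \<in> ?K\<^sup>*"
      using K[of a] symD[OF symK K[of b]] FV[OF ab] sideF[OF ab] by (auto intro: rtrancl_trans)
    then show False using tree_graph_bridge[OF tree, of a b] ab by (simp add: F_def)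
  qed
  have "hub_tree G u v par dep side"
  proof
    show "dep u = 0" "dep v = 0" using dep_least[of u 0] dep_least[of v 0] side_u side_v
      by (auto simp: root_def)
    show "par w \<in> ?V" "dep w = Suc (dep (par w))" "side (par w) = side w"
      if "w \<in> ?V - {u, v}" for w
      using par[OF that] FV sideF by blast+
    show "?E = {(u, v), (v, u)} \<union> (\<lambda>w. (w, par w)) ` (?V - {u, v}) \<union> (\<lambda>w. (par w, w)) ` (?V - {u, v})"
      (is "_ = ?R")
    proof
      show "?E \<subseteq> ?R" using arcs by (auto simp: F_def image_iff)
      show "?R \<subseteq> ?E" using par uv arcs_symmetric by (auto simp: F_def)
    qed
  qed (use uV side_u side_v pair_finite_verts in auto)
  then show ?thesis by blast
qed

lemma tree_graph_imp_deep_hub_tree: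
  assumes "1 \<le> r" and tree: "tree_graph G" and diam: "graph_diameter G = ereal (real (2 * r + 1))"
  shows "\<exists>u v par dep side. deep_hub_tree G u v par dep side r"
proof -
  interpret pair_graph G using tree by (simp add: tree_graph_def)
  note diamD = graph_diameter_eqD[OF pair_wf_digraph diam]
  obtain x y where x: "x \<in> pverts G" and y: "y \<in> pverts G"
    and far: "\<And>k. (x, y) \<in> parcs G ^^ k \<Longrightarrow> 2 * r + 1 \<le> k"
    using diamD(2) by auto
  obtain k where k: "k \<le> 2 * r + 1" "(x, y) \<in> parcs G ^^ k" using diamD(1)[OF _ x y] by auto
  \<comment> \<open>A walk between two vertices at maximal distance has exactly this length; its
    middle step is the central edge.\<close>
  then have "k = r + (1 + r)" using far[OF k(2)] by simp
  then have "(x, y) \<in> parcs G ^^ r O (parcs G O parcs G ^^ r)"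
    using k(2) by (simp only: relpow_add relpow_1)
  then obtain u v where uv: "(u, v) \<in> parcs G" and xu: "(x, u) \<in> parcs G ^^ r" and vy: "(v, y) \<in> parcs G ^^ r"
    by blast
  obtain par dep side where "hub_tree G u v par dep side"
    using tree_graph_imp_hub_tree[OF tree uv] by blast
  then interpret hub_tree G u v par dep side .
  have "2 * r + 1 \<le> (if side x = side y then dep x + dep y else dep x + dep y + 1)"
    using far walk_same_side[OF x y] walk_opposite_side[OF x y] by auto
  \<comment> \<open>On the side of \<open>v\<close>, \<open>x\<close> would need depth above
    \<open>r\<close>, or else \<open>y\<close> would be too close; but \<open>x\<close> is only
    \<open>r\<close> steps from \<open>u\<close>. The next claim treats \<open>y\<close>
    likewise.\<close>
  moreover have "2 * r + 1 \<le> dep x + r" if "\<not> side x"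
  proof -
    have "(hub False, y) \<in> parcs G ^^ r" using vy by (simp add: hub_def)
    then have "(x, y) \<in> parcs G ^^ (dep x + r)"
      using walk_to_hub[OF x] that by (auto simp: relpow_add)
    then show ?thesis by (rule far)
  qed
  moreover have "2 * r + 1 \<le> r + dep y" if "side y"
  proof -
    have "(x, hub True) \<in> parcs G ^^ r" using xu by (simp add: hub_def)
    then have "(x, y) \<in> parcs G ^^ (r + dep y)"
      using sym_relpow[OF walk_to_hub[OF y]] that by (auto simp: relpow_add)
    then show ?thesis by (rule far)
  qed
  moreover have "\<bar>pos x\<bar> \<le> int r" "\<bar>1 - pos y\<bar> \<le> int r"
    using pos_walk[OF xu] pos_walk[OF vy] side_hub dep_hub by (auto simp: pos_def)
  ultimately have xy: "side x" "\<not> side y" "dep x = r" "dep y = r"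
    using \<open>1 \<le> r\<close> by (auto simp: pos_def split: if_splits)
  \<comment> \<open>To a vertex of depth \<open>r\<close> on the other side the distance is at least
    \<open>dep w + r + 1\<close>, and it is at most the diameter.\<close>
  have "dep w \<le> r" if w: "w \<in> pverts G" for w
  proof -
    obtain z where z: "z \<in> pverts G" "side z \<noteq> side w" "dep z = r" using x y xy by metis
    obtain k where "k \<le> 2 * r + 1" "(w, z) \<in> parcs G ^^ k"
      using diamD(1)[OF _ w z(1)] by auto
    then show ?thesis using walk_opposite_side_ge[of w z k] z by auto
  qed
  then have "deep_hub_tree G u v par dep side r"
    using \<open>1 \<le> r\<close> x y xy by unfold_locales (metis (full_types))+
  then show ?thesis by blast
qed

section \<open>Double spiders and their eigenfunctions\<close>

fun spider_par :: "spider_vertex \<Rightarrow> spider_vertex" where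
  "spider_par (Hub s) = Hub s"
| "spider_par (Leg s i k) = leg_vertex s i (k - 1)"

fun spider_dep :: "spider_vertex \<Rightarrow> nat" where
  "spider_dep (Hub s) = 0"
| "spider_dep (Leg s i k) = k"

fun spider_side :: "spider_vertex \<Rightarrow> bool" where
  "spider_side (Hub s) = s"
| "spider_side (Leg s i k) = s"

lemma leg_vertex_pos: "0 < k \<Longrightarrow> leg_vertex s i k = Leg s i k"
  by (cases k) auto

lemma spider_dep_leg_vertex [simp]: "spider_dep (leg_vertex s i k) = k"
  by (cases k) auto

lemma spider_side_leg_vertex [simp]: "spider_side (leg_vertex s i k) = s"
  by (cases k) auto

locale bounded_spider =
  fixes as bs :: "nat list" and r :: nat
  assumes r_pos: "1 \<le> r"
    and legs_bounds: "\<forall>a\<in>set as. 1 \<le> a \<and> a \<le> r" "\<forall>b\<in>set bs. 1 \<le> b \<and> b \<le> r"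
    and r_in_legs: "r \<in> set as" "r \<in> set bs"
begin

definition legs :: "bool \<Rightarrow> nat list" where
  "legs s = (if s then as else bs)"

definition leg_index :: "(bool \<times> nat) set" where
  "leg_index = {(s, i). i < length (legs s)}"

definition leg_length :: "bool \<Rightarrow> nat \<Rightarrow> nat" where
  "leg_length s i = legs s ! i"

abbreviation "D \<equiv> double_spider as bs"

lemma leg_length_bounds:
  assumes "(s, i) \<in> leg_index"
  shows "1 \<le> leg_length s i" "leg_length s i \<le> r"
  using assms legs_bounds by (auto simp: leg_index_def leg_length_def legs_def)

lemma full_leg: obtains i where "(s, i) \<in> leg_index" "leg_length s i = r"
proof -
  have "r \<in> set (legs s)" using r_in_legs by (simp add: legs_def)
  then show ?thesis using that by (auto simp: leg_index_def leg_length_def in_set_conv_nth)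
qed

lemma non_hub_verts_eq:
  "pverts D - {Hub True, Hub False} =
     {Leg s i k | s i k. (s, i) \<in> leg_index \<and> 1 \<le> k \<and> k \<le> leg_length s i}" (is "?N = ?R")
proof
  show "?N \<subseteq> ?R"
  proof
    fix x assume "x \<in> ?N"
    then obtain s i k where x: "x = leg_vertex s i k" "i < length (legs s)" "k \<le> legs s ! i"
      "x \<noteq> Hub True" "x \<noteq> Hub False"
      by (auto simp: double_spider_def Let_def legs_def)
    then have "k \<noteq> 0" by (intro notI) (cases s; simp)
    then show "x \<in> ?R" using x by (auto simp: leg_vertex_pos leg_index_def leg_length_def)
  qed
  show "?R \<subseteq> ?N"
  proof
    fix x assume "x \<in> ?R"
    then obtain s i k where x: "x = Leg s i k" "i < length (legs s)" "1 \<le> k" "k \<le> legs s ! i"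
      unfolding leg_index_def leg_length_def by blast
    then have "leg_vertex s i k \<in> {leg_vertex s i k | s i k. i < length (legs s) \<and> k \<le> legs s ! i}"
      by (intro CollectI exI[of _ s] exI[of _ i] exI[of _ k]) simp
    then have "leg_vertex s i k \<in> pverts D"
      by (simp only: double_spider_def Let_def legs_def pair_pre_digraph.simps Un_iff simp_thms)
    then show "x \<in> ?N" using x by (simp add: leg_vertex_pos)
  qed
qed

lemma hubs_in_verts: "Hub s \<in> pverts D"
  by (cases s) (simp_all add: double_spider_def Let_def)

lemma finite_leg_index: "finite leg_index"
proof -
  have "leg_index = (SIGMA s:UNIV. {..<length (legs s)})" by (auto simp: leg_index_def)
  then show ?thesis by auto
qed

lemma finite_spider_verts: "finite (pverts D)"
proof -
  have "pverts D - {Hub True, Hub False} \<subseteq> (\<lambda>((s, i), k). Leg s i k) ` (leg_index \<times> {..r})"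
  proof
    fix x assume "x \<in> pverts D - {Hub True, Hub False}"
    then obtain s i k where "x = Leg s i k" "(s, i) \<in> leg_index" "k \<le> leg_length s i"
      unfolding non_hub_verts_eq by blast
    then show "x \<in> (\<lambda>((s, i), k). Leg s i k) ` (leg_index \<times> {..r})"
      using leg_length_bounds[of s i] by (intro image_eqI[of _ _ "((s, i), k)"]) auto
  qed
  then have "finite (pverts D - {Hub True, Hub False})"
    by (rule finite_subset) (simp add: finite_leg_index)
  then show ?thesis by simp
qed

lemma spider_arcs_eq:
  "parcs D = {(Hub True, Hub False), (Hub False, Hub True)}
    \<union> (\<lambda>w. (w, spider_par w)) ` (pverts D - {Hub True, Hub False})
    \<union> (\<lambda>w. (spider_par w, w)) ` (pverts D - {Hub True, Hub False})"
proof -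
  let ?N = "pverts D - {Hub True, Hub False}"
  let ?A = "{(leg_vertex s i k, leg_vertex s i (Suc k)) | s i k.
                 i < length (legs s) \<and> k < legs s ! i}"
  have A: "?A = (\<lambda>w. (spider_par w, w)) ` ?N"
  proof
    show "?A \<subseteq> (\<lambda>w. (spider_par w, w)) ` ?N"
    proof
      fix e assume "e \<in> ?A"
      then obtain s i k where e: "e = (leg_vertex s i k, leg_vertex s i (Suc k))"
        and "i < length (legs s)" "k < legs s ! i" by blast
      then have "Leg s i (Suc k) \<in> ?N"
        unfolding non_hub_verts_eq leg_index_def leg_length_def by auto
      then show "e \<in> (\<lambda>w. (spider_par w, w)) ` ?N"
        using e by (intro image_eqI[of _ _ "Leg s i (Suc k)"]) auto
    qed
    show "(\<lambda>w. (spider_par w, w)) ` ?N \<subseteq> ?A"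
    proof
      fix e assume "e \<in> (\<lambda>w. (spider_par w, w)) ` ?N"
      then obtain s i k where "e = (leg_vertex s i (k - 1), Leg s i k)" "i < length (legs s)"
        "1 \<le> k" "k \<le> legs s ! i"
        by (auto simp: non_hub_verts_eq leg_index_def leg_length_def)
      then show "e \<in> ?A"
        by (intro CollectI exI[of _ s] exI[of _ i] exI[of _ "k - 1"]) (auto simp: leg_vertex_pos)
    qed
  qed
  have "parcs D = ({(Hub True, Hub False)} \<union> ?A) \<union> ({(Hub True, Hub False)} \<union> ?A)\<inverse>"
    by (simp add: double_spider_def Let_def legs_def)
  also have "\<dots> = {(Hub True, Hub False), (Hub False, Hub True)}
    \<union> (\<lambda>w. (w, spider_par w)) ` ?N \<union> (\<lambda>w. (spider_par w, w)) ` ?N"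
    unfolding A by auto
  finally show ?thesis .
qed

text \<open>Gives \<open>D\<close> the same formulas for energy and leaves as \<open>T\<close>,
  together with its diameter.\<close>

sublocale S: deep_hub_tree D "Hub True" "Hub False" spider_par spider_dep spider_side r
proof
  fix w assume w: "w \<in> pverts D - {Hub True, Hub False}"
  then obtain s i k where k: "w = Leg s i k" "(s, i) \<in> leg_index" "1 \<le> k" "k \<le> leg_length s i"
    unfolding non_hub_verts_eq by blast
  show "spider_par w \<in> pverts D"
  proof (cases "k = 1")
    case True
    then show ?thesis using k hubs_in_verts by simp
  next
    case False
    then have "spider_par w = Leg s i (k - 1)" "1 \<le> k - 1" "k - 1 \<le> leg_length s i"
      using k by (auto simp: leg_vertex_pos)
    then have "spider_par w \<in> pverts D - {Hub True, Hub False}"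
      using k(2) unfolding non_hub_verts_eq by blast
    then show ?thesis by simp
  qed
  show "spider_dep w = Suc (spider_dep (spider_par w))" "spider_side (spider_par w) = spider_side w"
    using k by auto
next
  fix w assume w: "w \<in> pverts D"
  show "spider_dep w \<le> r"
  proof (cases "w \<in> pverts D - {Hub True, Hub False}")
    case True
    then show ?thesis unfolding non_hub_verts_eq using leg_length_bounds by force
  qed (use w in auto)
next
  fix s
  obtain i where i: "(s, i) \<in> leg_index" "leg_length s i = r" by (rule full_leg)
  then have "Leg s i r \<in> pverts D - {Hub True, Hub False}"
    unfolding non_hub_verts_eq using r_pos by blast
  then show "\<exists>w\<in>pverts D. spider_side w = s \<and> spider_dep w = r"
    by (intro bexI[of _ "Leg s i r"]) auto
qed (use hubs_in_verts finite_spider_verts spider_arcs_eq r_pos in auto)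

lemma hub_eq [simp]: "S.hub s = Hub s"
  by (simp add: S.hub_def)

lemma Leg_in_N_iff: "Leg s i k \<in> S.N \<longleftrightarrow> (s, i) \<in> leg_index \<and> 1 \<le> k \<and> k \<le> leg_length s i"
  unfolding non_hub_verts_eq by blast

lemma in_N_cases:
  assumes "x \<in> S.N"
  obtains s i k where "x = Leg s i k" "(s, i) \<in> leg_index" "1 \<le> k" "k \<le> leg_length s i"
  using assms unfolding non_hub_verts_eq by blast

lemma children_eq:
  assumes "Leg s i k \<in> S.N"
  shows "{z \<in> S.N. spider_par z = Leg s i k} = (if k < leg_length s i then {Leg s i (Suc k)} else {})"
proof -
  have "spider_par z = Leg s i k \<longleftrightarrow> z = Leg s i (Suc k)" if z: "z \<in> S.N" for z
  proof (rule in_N_cases[OF z])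
    fix s' i' k' assume z': "z = Leg s' i' k'" "1 \<le> k'"
    show ?thesis
    proof (cases "k' = 1")
      case True
      then show ?thesis using z' assms Leg_in_N_iff[of s i k] by auto
    next
      case False
      then show ?thesis using z' by (auto simp: leg_vertex_pos)
    qed
  qed
  then have "{z \<in> S.N. spider_par z = Leg s i k} = {z. z = Leg s i (Suc k) \<and> z \<in> S.N}" by blast
  also have "\<dots> = (if Leg s i (Suc k) \<in> S.N then {Leg s i (Suc k)} else {})"
    by (rule Collect_conv_if)
  also have "Leg s i (Suc k) \<in> S.N \<longleftrightarrow> k < leg_length s i"
    using assms unfolding Leg_in_N_iff by auto
  finally show ?thesis .
qed

lemma spider_leaves_eq: "leaves D = (\<lambda>(s, i). Leg s i (leg_length s i)) ` leg_index"
proof -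
  have "Leg s i k \<in> leaves D \<longleftrightarrow> k = leg_length s i" if "Leg s i k \<in> S.N" for s i k
  proof -
    have "Leg s i k \<in> leaves D \<longleftrightarrow> {z \<in> S.N. spider_par z = Leg s i k} = {}"
      unfolding S.leaves_eq using that by auto
    then show ?thesis
      unfolding children_eq[OF that] using that Leg_in_N_iff[of s i k] by auto
  qed
  note leaf = this
  have sub: "leaves D \<subseteq> S.N" unfolding S.leaves_eq by blast
  show ?thesis
  proof
    show "leaves D \<subseteq> (\<lambda>(s, i). Leg s i (leg_length s i)) ` leg_index"
    proof
      fix x assume x: "x \<in> leaves D"
      then have "x \<in> S.N" using sub by blast
      then show "x \<in> (\<lambda>(s, i). Leg s i (leg_length s i)) ` leg_index"
        by (rule in_N_cases) (use x leaf Leg_in_N_iff in force)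
    qed
    show "(\<lambda>(s, i). Leg s i (leg_length s i)) ` leg_index \<subseteq> leaves D"
      using leaf leg_length_bounds Leg_in_N_iff by auto
  qed
qed

text \<open>
  The test function \<open>f\<close> is linear with increment 2 on a path of \<open>2 r + 1\<close> edges through both
  hubs and constant on all other legs; it gives \<open>\<lambda>\<^sub>2 \<le> 2 / (2 r + 1)\<close>.
\<close>

lemma spider_lambda2_less: "steklov_lambda2 D * r < 1"
proof -
  obtain i where i: "(True, i) \<in> leg_index" "leg_length True i = r" by (rule full_leg)
  obtain j where j: "(False, j) \<in> leg_index" "leg_length False j = r" by (rule full_leg)
  define ix where "ix s = (if s then i else j)" for s
  have ix: "(s, ix s) \<in> leg_index" "leg_length s (ix s) = r" for s
    using i j by (auto simp: ix_def)
  define sg :: "bool \<Rightarrow> real" where "sg s = (if s then 1 else - 1)" for s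
  have sg: "(sg s)\<^sup>2 = 1" "sg s * sg s = 1" for s by (auto simp: sg_def)
  define f :: "spider_vertex \<Rightarrow> real" where
    "f x = (case x of Hub s \<Rightarrow> sg s
       | Leg s i' k \<Rightarrow> if i' = ix s then sg s * (1 + 2 * real k) else sg s)" for x
  let ?P = "(\<lambda>(s, k). Leg s (ix s) k) ` (UNIV \<times> {1..r})"
  have "(f w - f (spider_par w))\<^sup>2 = (if w \<in> ?P then 4 else 0)" if w: "w \<in> S.N" for w
  proof (rule in_N_cases[OF w])
    fix s i' k assume x: "w = Leg s i' k" "(s, i') \<in> leg_index" "1 \<le> k" "k \<le> leg_length s i'"
    have P: "w \<in> ?P \<longleftrightarrow> i' = ix s" using x ix by (auto simp: image_iff)
    obtain k' where k': "k = Suc k'" using x by (cases k) auto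
    have fp: "f (leg_vertex s i' k') = (if i' = ix s then sg s * (1 + 2 * real k') else sg s)"
      by (cases k') (auto simp: f_def)
    have "f w - f (spider_par w) = (if i' = ix s then sg s * 2 else 0)"
      using x(1) k' fp by (simp add: f_def algebra_simps)
    then show ?thesis using P by (simp add: power_mult_distrib sg)
  qed
  then have "(\<Sum>w\<in>S.N. (f w - f (spider_par w))\<^sup>2) = (\<Sum>w\<in>S.N. if w \<in> ?P then 4 else 0)"
    by (intro sum.cong) auto
  also have "\<dots> = (\<Sum>w\<in>S.N \<inter> ?P. 4)"
    using finite_spider_verts by (subst sum.inter_restrict) auto
  also have "S.N \<inter> ?P = ?P"
    using ix Leg_in_N_iff by auto
  also have "(\<Sum>w\<in>?P. 4) = (\<Sum>x\<in>(UNIV::bool set) \<times> {1..r}. 4::real)"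
    by (subst sum.reindex) (auto simp: inj_on_def)
  also have "\<dots> = 8 * r" by simp
  \<comment> \<open>Each of the \<open>2 * r + 1\<close> edges of the path, the central one
    included, contributes 4.\<close>
  finally have energy: "dirichlet_energy D f = 4 + 8 * r"
    unfolding S.energy_eq by (simp add: f_def sg_def)
  define L where "L = leaves D"
  define m where "m = (\<Sum>x\<in>L. f x) / card L"
  have finL: "finite L" unfolding L_def by (rule S.steklov.finite_leaves)
  let ?a = "Leg True i r" and ?b = "Leg False j r"
  have ab: "?a \<in> L" "?b \<in> L" using i j unfolding L_def spider_leaves_eq by force+
  have fab: "f ?a = 1 + 2 * real r" "f ?b = - (1 + 2 * real r)" by (auto simp: f_def ix_def sg_def)
  \<comment> \<open>The end values are opposite, so subtracting \<open>m\<close> from both adds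
    \<open>2 * m\<^sup>2\<close>; whatever the mean, these two leaves alone bound the variance from
    below.\<close>
  have "2 * (1 + 2 * real r)\<^sup>2 \<le> (f ?a - m)\<^sup>2 + (f ?b - m)\<^sup>2"
    unfolding fab by (simp add: power2_eq_square algebra_simps)
  also have "\<dots> = (\<Sum>x\<in>{?a, ?b}. (f x - m)\<^sup>2)" by simp
  also have "\<dots> \<le> (\<Sum>x\<in>L. (f x - m)\<^sup>2)"
    using ab finL by (intro sum_mono2) auto
  also have "\<dots> = (\<Sum>x\<in>L. (f x)\<^sup>2) - (\<Sum>x\<in>L. f x)\<^sup>2 / card L"
    unfolding m_def using finL S.steklov.leaves_nonempty
    by (intro sum_power2_diff_mean) (simp_all add: L_def)
  finally have var: "2 * (1 + 2 * real r)\<^sup>2 \<le> (\<Sum>x\<in>L. (f x)\<^sup>2) - (\<Sum>x\<in>L. f x)\<^sup>2 / card L" .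
  have "steklov_lambda2 D * (2 * (1 + 2 * real r)\<^sup>2)
      \<le> steklov_lambda2 D * ((\<Sum>x\<in>L. (f x)\<^sup>2) - (\<Sum>x\<in>L. f x)\<^sup>2 / card L)"
    using var S.steklov.steklov_lambda2_pos by (intro mult_left_mono) auto
  also have "\<dots> \<le> 4 * (1 + 2 * real r)"
    using S.steklov.steklov_lambda2_le[of f] energy by (simp add: L_def)
  finally have "(1 + 2 * real r) * (steklov_lambda2 D * (1 + 2 * real r)) \<le> (1 + 2 * real r) * 2"
    by (simp add: power2_eq_square algebra_simps)
  then have "steklov_lambda2 D * (1 + 2 * real r) \<le> 2"
    by (simp only: mult_le_cancel_left_pos)
  \<comment> \<open>The central edge supplies the strictness: it is the 1 in
    \<open>1 + 2 * real r\<close>.\<close>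
  then show ?thesis using S.steklov.steklov_lambda2_pos by (simp add: algebra_simps)
qed

text \<open>An inner vertex of a leg has two neighbours, so harmonicity there equates consecutive
  increments; the eigenvalue enters only at the leaf.\<close>

lemma spider_eigenfunction:
  obtains h slope where "(\<Sum>x\<in>leaves D. h x) = 0" "(\<Sum>x\<in>leaves D. (h x)\<^sup>2) = 1"
    "dirichlet_energy D h = steklov_lambda2 D"
    "\<And>s i k. (s, i) \<in> leg_index \<Longrightarrow> k \<le> leg_length s i \<Longrightarrow> h (leg_vertex s i k) = h (Hub s) + k * slope s i"
    "\<And>s i. (s, i) \<in> leg_index \<Longrightarrow> slope s i = steklov_lambda2 D * h (Leg s i (leg_length s i))"
    "\<And>s i. (s, i) \<in> leg_index \<Longrightarrow> 0 \<le> slope s i * h (Hub s)"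
    "\<And>s i. (s, i) \<in> leg_index \<Longrightarrow> slope s i = 0 \<longleftrightarrow> h (Hub s) = 0"
proof -
  let ?l = "steklov_lambda2 D"
  obtain h where h: "(\<Sum>x\<in>leaves D. h x) = 0" "(\<Sum>x\<in>leaves D. (h x)\<^sup>2) = 1"
    "dirichlet_energy D h = ?l"
    "\<And>v. v \<in> pverts D \<Longrightarrow> S.steklov.laplacian h v = (if v \<in> leaves D then ?l * h v else 0)"
    by (rule S.steklov.steklov_eigenfunction) blast
  define slope where "slope s i = h (Leg s i 1) - h (Hub s)" for s i
  have lap: "S.steklov.laplacian h (Leg s i k) = (h (Leg s i k) - h (leg_vertex s i (k - 1)))
      + (if k < leg_length s i then h (Leg s i k) - h (Leg s i (Suc k)) else 0)"
    if x: "Leg s i k \<in> S.N" for s i k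
    unfolding S.steklov.laplacian_def S.neighbours_eq(1)[OF x]
    using S.neighbours_eq(2)[OF x] unfolding children_eq[OF x] by auto
  have leaf: "Leg s i k \<in> leaves D \<longleftrightarrow> k = leg_length s i" if "(s, i) \<in> leg_index" for s i k
    using that unfolding spider_leaves_eq by auto
  have diff: "h (leg_vertex s i (Suc k)) - h (leg_vertex s i k) = slope s i"
    if i: "(s, i) \<in> leg_index" and k: "k < leg_length s i" for s i k
    using k
  proof (induction k)
    case (Suc k)
    then have x: "Leg s i (Suc k) \<in> S.N" using i by (auto simp only: Leg_in_N_iff)
    then have "S.steklov.laplacian h (Leg s i (Suc k)) = 0"
      using h(4) leaf[OF i] Suc.prems by auto
    then show ?case unfolding lap[OF x] using Suc by simp
  qed (simp add: slope_def)
  have lin: "h (leg_vertex s i k) = h (Hub s) + k * slope s i"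
    if i: "(s, i) \<in> leg_index" and k: "k \<le> leg_length s i" for s i k
    using k
  proof (induction k)
    case (Suc k)
    then show ?case using diff[OF i, of k] by (simp add: algebra_simps)
  qed simp
  have slope: "slope s i = ?l * h (Leg s i (leg_length s i))" if i: "(s, i) \<in> leg_index" for s i
  proof -
    let ?k = "leg_length s i"
    obtain k' where k': "?k = Suc k'" using leg_length_bounds[OF i] by (cases ?k) auto
    have x: "Leg s i ?k \<in> S.N" using i leg_length_bounds[OF i] by (auto simp only: Leg_in_N_iff)
    then have "S.steklov.laplacian h (Leg s i ?k) = ?l * h (Leg s i ?k)"
      using h(4) leaf[OF i] by auto
    then show ?thesis unfolding lap[OF x] using diff[OF i, of k'] k' by simp
  qed
  \<comment> \<open>Substituting the linear formula into the leaf condition eliminates the leaf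
    value. The factor is positive, so the slope inherits the sign of the hub value.\<close>
  have rel: "slope s i * (1 - ?l * leg_length s i) = ?l * h (Hub s)"
    and pos: "0 < 1 - ?l * leg_length s i" if i: "(s, i) \<in> leg_index" for s i
  proof -
    have "h (Leg s i (leg_length s i)) = h (Hub s) + leg_length s i * slope s i"
      using lin[OF i order_refl] leg_length_bounds[OF i] by (simp add: leg_vertex_pos)
    then have "slope s i = ?l * (h (Hub s) + leg_length s i * slope s i)"
      using slope[OF i] by simp
    then show "slope s i * (1 - ?l * leg_length s i) = ?l * h (Hub s)"
      by (simp add: algebra_simps)
    have "?l * leg_length s i \<le> ?l * r"
      using leg_length_bounds[OF i] S.steklov.steklov_lambda2_pos by (intro mult_left_mono) auto
    then show "0 < 1 - ?l * leg_length s i" using spider_lambda2_less by simp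
  qed
  have sgn: "0 \<le> slope s i * h (Hub s)" if i: "(s, i) \<in> leg_index" for s i
  proof -
    have "?l * (slope s i * h (Hub s)) = slope s i * (slope s i * (1 - ?l * leg_length s i))"
      unfolding rel[OF i] by simp
    also have "\<dots> = (slope s i)\<^sup>2 * (1 - ?l * leg_length s i)"
      by (simp add: power2_eq_square)
    also have "\<dots> \<ge> 0" using pos[OF i] by simp
    finally show ?thesis using S.steklov.steklov_lambda2_pos by (simp add: zero_le_mult_iff)
  qed
  have zero: "slope s i = 0 \<longleftrightarrow> h (Hub s) = 0" if i: "(s, i) \<in> leg_index" for s i
    using rel[OF i] pos[OF i] S.steklov.steklov_lambda2_pos by (metis less_irrefl mult_eq_0_iff mult_zero_right)
  show thesis by (rule that[OF h(1-3) lin slope sgn zero])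
qed

end

section \<open>Comparing a tree with its double spider\<close>

text \<open>
  \<open>\<psi>\<close> maps each leg of \<open>D\<close> onto a descending path of \<open>T\<close> that ends at a leaf; only the first
  vertex of a leg may lose its parent.
\<close>

locale spider_unfolding = T: deep_hub_tree T u v par dep side r + bounded_spider as bs r
  for T :: "'a pair_pre_digraph" and u v par dep side r as bs +
  fixes \<psi> :: "spider_vertex \<Rightarrow> 'a"
  assumes bij: "bij_betw \<psi> (pverts D) (pverts T)"
    and psi_Hub: "\<psi> (Hub s) = T.hub s"
    and psi_side: "x \<in> pverts D \<Longrightarrow> side (\<psi> x) = spider_side x"
    and psi_leaf: "x \<in> pverts D \<Longrightarrow> \<psi> x \<in> leaves T \<longleftrightarrow> x \<in> leaves D"
    and psi_par: "x \<in> pverts D - {Hub True, Hub False} \<Longrightarrow>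
      par (\<psi> x) = \<psi> (spider_par x) \<or> spider_par x = Hub (spider_side x)"
begin

abbreviation "\<phi> \<equiv> inv_into (pverts D) \<psi>"

lemma phi_psi: "x \<in> pverts D \<Longrightarrow> \<phi> (\<psi> x) = x"
  using bij by (simp add: bij_betw_def)

lemma psi_surj: "w \<in> pverts T \<Longrightarrow> \<exists>x\<in>pverts D. \<psi> x = w"
  using bij by (metis bij_betw_def imageE)

lemma bij_N: "bij_betw \<psi> S.N T.N"
proof -
  have "\<psi> ` {Hub True, Hub False} = {u, v}" by (simp add: psi_Hub T.hub_def)
  moreover have "{Hub True, Hub False} \<subseteq> pverts D" using hubs_in_verts by blast
  ultimately have "bij_betw \<psi> {Hub True, Hub False} {u, v}"
    using bij_betw_subset[OF bij] by blast
  then show ?thesis using bij_betw_DiffI[OF bij] T.hub_in_verts hubs_in_verts by blast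
qed

lemma psi_in_N: "x \<in> S.N \<Longrightarrow> \<psi> x \<in> T.N"
  using bij_N by (rule bij_betw_apply)

lemma bij_leaves: "bij_betw \<psi> (leaves D) (leaves T)"
proof (rule bij_betw_subset[OF bij S.steklov.leaves_subset])
  show "\<psi> ` leaves D = leaves T"
    using psi_leaf psi_surj S.steklov.leaves_subset T.steklov.leaves_subset by blast
qed

text \<open>An integral down from the hub: the edge above each ancestor of \<open>w\<close>
  contributes the increment of \<open>h\<close> over the edge above the corresponding vertex of
  \<open>D\<close>.\<close>

definition transplant :: "(spider_vertex \<Rightarrow> real) \<Rightarrow> 'a \<Rightarrow> real" where
  "transplant h w = h (Hub (side w)) +
     (\<Sum>j<dep w. h (\<phi> ((par ^^ j) w)) - h (spider_par (\<phi> ((par ^^ j) w))))"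

lemma transplant_hub: "transplant h (T.hub s) = h (Hub s)"
  by (simp add: transplant_def)

lemma transplant_psi:
  assumes "x \<in> S.N"
  shows "transplant h (\<psi> x) = transplant h (par (\<psi> x)) + (h x - h (spider_par x))"
proof -
  have w: "\<psi> x \<in> T.N" using assms by (rule psi_in_N)
  have "\<phi> (\<psi> x) = x" using assms phi_psi by blast
  then show ?thesis
    unfolding transplant_def T.dep_par[OF w] T.side_par[OF w]
    by (simp only: sum.lessThan_Suc_shift funpow_0 funpow_Suc_right o_apply)
qed

text \<open>Edges other than the central one are indexed by their lower ends, which
  \<open>\<psi>\<close> matches; their increments agree wherever the upper end has moved.\<close>

lemma energy_transplant: "dirichlet_energy T (transplant h) = dirichlet_energy D h"
proof -
  have "(\<Sum>w\<in>T.N. (transplant h w - transplant h (par w))\<^sup>2) =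
      (\<Sum>x\<in>S.N. (transplant h (\<psi> x) - transplant h (par (\<psi> x)))\<^sup>2)"
    by (rule sum.reindex_bij_betw[OF bij_N, symmetric])
  also have "\<dots> = (\<Sum>x\<in>S.N. (h x - h (spider_par x))\<^sup>2)"
    by (rule sum.cong[OF refl]) (simp only: transplant_psi add_diff_cancel_left')
  finally show ?thesis
    unfolding T.energy_eq S.energy_eq
    using transplant_hub[of h True] transplant_hub[of h False] by (simp add: T.hub_def)
qed

text \<open>
  If \<open>h\<close> sums to zero on the leaves of \<open>D\<close> and the transplant moves every leaf value away
  from zero, the leaf variance can only grow, at least by twice the inner product of \<open>h\<close>
  and the shift.
\<close>

lemma lambda2_shift_le:
  assumes "(\<Sum>x\<in>leaves D. h x) = 0" "(\<Sum>x\<in>leaves D. (h x)\<^sup>2) = 1"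
    and "dirichlet_energy D h = steklov_lambda2 D"
  shows "steklov_lambda2 T * (1 + 2 * (\<Sum>x\<in>leaves D. h x * (transplant h (\<psi> x) - h x)))
    \<le> steklov_lambda2 D"
proof -
  let ?L = "leaves D" and ?F = "transplant h"
  define t where "t x = ?F (\<psi> x) - h x" for x
  have Ft: "?F (\<psi> x) = h x + t x" for x by (simp add: t_def)
  have card: "card (leaves T) = card ?L" using bij_betw_same_card[OF bij_leaves] by simp
  have fin: "finite ?L" "?L \<noteq> {}" by (rule S.steklov.finite_leaves S.steklov.leaves_nonempty)+
  have "(\<Sum>w\<in>leaves T. (?F w)\<^sup>2) = (\<Sum>x\<in>?L. (h x + t x)\<^sup>2)"
    unfolding Ft[symmetric] by (rule sum.reindex_bij_betw[OF bij_leaves, symmetric])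
  also have "\<dots> = 1 + 2 * (\<Sum>x\<in>?L. h x * t x) + (\<Sum>x\<in>?L. (t x)\<^sup>2)"
    by (simp add: power2_sum sum.distrib assms(2) sum_distrib_left mult.assoc)
  finally have sq: "(\<Sum>w\<in>leaves T. (?F w)\<^sup>2) = 1 + 2 * (\<Sum>x\<in>?L. h x * t x) + (\<Sum>x\<in>?L. (t x)\<^sup>2)" .
  have "(\<Sum>w\<in>leaves T. ?F w) = (\<Sum>x\<in>?L. h x + t x)"
    unfolding Ft[symmetric] by (rule sum.reindex_bij_betw[OF bij_leaves, symmetric])
  then have su: "(\<Sum>w\<in>leaves T. ?F w) = (\<Sum>x\<in>?L. t x)" by (simp add: sum.distrib assms(1))
  have "0 \<le> (\<Sum>x\<in>?L. (t x - sum t ?L / card ?L)\<^sup>2)" by (simp add: sum_nonneg)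
  then have "0 \<le> (\<Sum>x\<in>?L. (t x)\<^sup>2) - (sum t ?L)\<^sup>2 / card ?L"
    unfolding sum_power2_diff_mean[OF fin] .
  then have "1 + 2 * (\<Sum>x\<in>?L. h x * t x)
      \<le> (\<Sum>w\<in>leaves T. (?F w)\<^sup>2) - (\<Sum>w\<in>leaves T. ?F w)\<^sup>2 / card (leaves T)"
    unfolding sq su card by simp
  then have "steklov_lambda2 T * (1 + 2 * (\<Sum>x\<in>?L. h x * t x)) \<le> steklov_lambda2 T *
      ((\<Sum>w\<in>leaves T. (?F w)\<^sup>2) - (\<Sum>w\<in>leaves T. ?F w)\<^sup>2 / card (leaves T))"
    using T.steklov.steklov_lambda2_pos by (intro mult_left_mono) auto
  also have "\<dots> \<le> dirichlet_energy T ?F" by (rule T.steklov.steklov_lambda2_le)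
  finally show ?thesis by (simp add: energy_transplant assms(3) t_def)
qed

text \<open>The shift \<open>t\<close> never has the sign opposite to the hub value \<alpha> of its
  side, and \<open>h\<close> on a leaf is a nonnegative multiple of \<alpha>. So every term
  \<open>h x * t x\<close> is nonnegative, and for strictness one positive term suffices.\<close>

lemma lambda2_le:
  shows steklov_lambda2_le_spider: "steklov_lambda2 T \<le> steklov_lambda2 D"
    and steklov_lambda2_less_spider:
      "x\<^sub>0 \<in> S.N \<Longrightarrow> par (\<psi> x\<^sub>0) \<noteq> \<psi> (spider_par x\<^sub>0) \<Longrightarrow> steklov_lambda2 T < steklov_lambda2 D"
proof -
  obtain h slope where h: "(\<Sum>x\<in>leaves D. h x) = 0" "(\<Sum>x\<in>leaves D. (h x)\<^sup>2) = 1"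
      "dirichlet_energy D h = steklov_lambda2 D"
    and lin: "\<And>s i k. (s, i) \<in> leg_index \<Longrightarrow> k \<le> leg_length s i \<Longrightarrow>
      h (leg_vertex s i k) = h (Hub s) + k * slope s i"
    and slope: "\<And>s i. (s, i) \<in> leg_index \<Longrightarrow> slope s i = steklov_lambda2 D * h (Leg s i (leg_length s i))"
    and slope_hub: "\<And>s i. (s, i) \<in> leg_index \<Longrightarrow> 0 \<le> slope s i * h (Hub s)"
    and slope_zero: "\<And>s i. (s, i) \<in> leg_index \<Longrightarrow> slope s i = 0 \<longleftrightarrow> h (Hub s) = 0"
    by (rule spider_eigenfunction) blast
  define t where "t x = transplant h (\<psi> x) - h x" for x
  define \<alpha> where "\<alpha> x = h (Hub (spider_side x))" for x
  have t_hub: "t (Hub s) = 0" for s by (simp add: t_def psi_Hub transplant_hub)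
  have t_straight: "t x = t (spider_par x)" if "x \<in> S.N" "par (\<psi> x) = \<psi> (spider_par x)" for x
    using transplant_psi[OF that(1), of h] that(2) by (simp add: t_def)
  \<comment> \<open>In \<open>D\<close> the increment at \<open>x\<close> starts from the hub value,
    in \<open>T\<close> from the value at \<open>y\<close>; the shift grows by what \<open>h\<close>
    has gained between the hub and \<open>y\<close>.\<close>
  have t_branch: "\<exists>y\<in>pverts D. \<psi> y = par (\<psi> x) \<and> \<alpha> y = \<alpha> x \<and> t x = t y + (h y - \<alpha> y)"
    if x: "x \<in> S.N" and nex: "par (\<psi> x) \<noteq> \<psi> (spider_par x)" for x
  proof -
    have w: "\<psi> x \<in> T.N" using x by (rule psi_in_N)
    obtain y where y: "y \<in> pverts D" "\<psi> y = par (\<psi> x)"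
      using psi_surj[OF T.par_in_verts[OF w]] by blast
    have "spider_side y = spider_side x"
      using psi_side[OF y(1)] psi_side[of x] T.side_par[OF w] x y(2) by simp
    moreover have "spider_par x = Hub (spider_side x)" using psi_par x nex by blast
    ultimately show ?thesis
      using transplant_psi[OF x, of h] y by (intro bexI[of _ y]) (auto simp: t_def \<alpha>_def)
  qed
  have outward: "0 \<le> (h y - \<alpha> y) * \<alpha> y" if y: "y \<in> pverts D" for y
  proof (cases "y \<in> S.N")
    case True
    then show ?thesis
    proof (rule in_N_cases)
      fix s i k assume *: "y = Leg s i k" "(s, i) \<in> leg_index" "1 \<le> k" "k \<le> leg_length s i"
      then have "h y = h (Hub s) + k * slope s i" using lin[of s i k] by (simp add: leg_vertex_pos)
      then show ?thesis using slope_hub[OF *(2)] *(1) by (simp add: \<alpha>_def mult.assoc)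
    qed
  qed (use y in \<open>auto simp: \<alpha>_def\<close>)
  have strictly_outward: "0 < (h y - \<alpha> y) * \<alpha> y" if y: "y \<in> S.N" "\<alpha> y \<noteq> 0" for y
    using y(1)
  proof (rule in_N_cases)
    fix s i k assume *: "y = Leg s i k" "(s, i) \<in> leg_index" "1 \<le> k" "k \<le> leg_length s i"
    then have "h y = h (Hub s) + k * slope s i" using lin[of s i k] by (simp add: leg_vertex_pos)
    moreover have "0 < slope s i * h (Hub s)"
      using slope_hub[OF *(2)] slope_zero[OF *(2)] y(2) * by (simp add: \<alpha>_def less_le)
    ultimately show ?thesis using * by (simp add: \<alpha>_def mult.assoc)
  qed
  have t_outward: "0 \<le> t x * \<alpha> x" if "x \<in> pverts D" for x
    using that
  \<comment> \<open>Depth is taken in \<open>T\<close>: the vertex \<open>y\<close> above the head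
    of a moved leg may be no closer to the hub of \<open>D\<close> than the head itself.\<close>
  proof (induction "dep (\<psi> x)" arbitrary: x rule: less_induct)
    case less
    show ?case
    proof (cases "x \<in> S.N")
      case True
      then have w: "\<psi> x \<in> T.N" by (rule psi_in_N)
      show ?thesis
      proof (cases "par (\<psi> x) = \<psi> (spider_par x)")
        case eq: True
        have "\<alpha> (spider_par x) = \<alpha> x" using S.side_par[OF True] by (simp add: \<alpha>_def)
        moreover have "0 \<le> t (spider_par x) * \<alpha> (spider_par x)"
          using T.dep_par[OF w] eq S.par_in_verts[OF True] by (intro less(1)) auto
        ultimately show ?thesis using t_straight[OF True eq] by simp
      next
        case neq: False
        obtain y where y: "y \<in> pverts D" "\<psi> y = par (\<psi> x)" "\<alpha> y = \<alpha> x" "t x = t y + (h y - \<alpha> y)"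
          using t_branch[OF True neq] by blast
        have "0 \<le> t y * \<alpha> y" using T.dep_par[OF w] y by (intro less(1)) auto
        then show ?thesis using outward[OF y(1)] y(3,4) by (simp add: distrib_right)
      qed
    next
      case False
      then have "x = Hub True \<or> x = Hub False" using less(2) by blast
      then show ?thesis using t_hub by auto
    qed
  qed
  have leaf: "\<exists>c\<ge>0. h x = c * \<alpha> x \<and> (\<alpha> x \<noteq> 0 \<longrightarrow> c > 0)" if x: "x \<in> leaves D" for x
  proof -
    obtain s i where si: "x = Leg s i (leg_length s i)" "(s, i) \<in> leg_index"
      using x unfolding spider_leaves_eq by auto
    have \<alpha>: "\<alpha> x = h (Hub s)" using si by (simp add: \<alpha>_def)
    note pos = S.steklov.steklov_lambda2_pos
    show ?thesis
    proof (cases "\<alpha> x = 0")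
      case True
      then have "h x = 0" using slope_zero[OF si(2)] slope[OF si(2)] \<alpha> si(1) pos by simp
      then show ?thesis by (intro exI[of _ 0]) (simp add: True)
    next
      case False
      then have "slope s i * h (Hub s) > 0"
        using slope_hub[OF si(2)] slope_zero[OF si(2)] \<alpha> by (simp add: less_le)
      then have "h x * \<alpha> x > 0"
        using slope[OF si(2)] \<alpha> si(1) pos by (simp add: mult.assoc zero_less_mult_iff)
      then have "h x / \<alpha> x > 0" by (simp add: zero_less_mult_iff zero_less_divide_iff)
      then show ?thesis using False by (intro exI[of _ "h x / \<alpha> x"]) simp
    qed
  qed
  have ht: "0 \<le> h x * t x" if x: "x \<in> leaves D" for x
  proof -
    obtain c where "c \<ge> 0" "h x = c * \<alpha> x" using leaf[OF x] by blast
    moreover have "0 \<le> t x * \<alpha> x" using t_outward x S.steklov.leaves_subset by blast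
    ultimately show ?thesis by (simp add: mult.assoc mult.commute[of "\<alpha> x"])
  qed
  note shift = lambda2_shift_le[OF h(1-3), folded t_def]
  have "0 \<le> (\<Sum>x\<in>leaves D. h x * t x)" by (intro sum_nonneg ht)
  then have "steklov_lambda2 T * 1 \<le> steklov_lambda2 T * (1 + 2 * (\<Sum>x\<in>leaves D. h x * t x))"
    using T.steklov.steklov_lambda2_pos by (intro mult_left_mono) auto
  with shift show "steklov_lambda2 T \<le> steklov_lambda2 D" by simp
  \<comment> \<open>If one hub value vanished, so would the leaf values on that side, while those on
    the other side could not differ in sign; sum zero would make them vanish too, against unit
    norm.\<close>
  have \<alpha>_neq: "h (Hub s) \<noteq> 0" for s
  proof
    assume zero: "h (Hub s) = 0"
    let ?a = "h (Hub (\<not> s))"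
    have \<alpha>: "\<alpha> x = 0 \<or> \<alpha> x = ?a" for x
      using zero by (cases "spider_side x = s") (auto simp: \<alpha>_def)
    have nonneg: "0 \<le> h x * ?a" if "x \<in> leaves D" for x
      using leaf[OF that] \<alpha>[of x] by (auto simp: mult.assoc)
    have "(\<Sum>x\<in>leaves D. h x * ?a) = 0" using h(1) by (simp add: sum_distrib_right[symmetric])
    then have prod: "\<forall>x\<in>leaves D. h x * ?a = 0"
      by (subst (asm) sum_nonneg_eq_0_iff[OF S.steklov.finite_leaves nonneg])
    have "h x = 0" if "x \<in> leaves D" for x
      using leaf[OF that] \<alpha>[of x] bspec[OF prod that] by auto
    then show False using h(2) by simp
  qed
  show "steklov_lambda2 T < steklov_lambda2 D"
    if x0: "x\<^sub>0 \<in> S.N" and nex: "par (\<psi> x\<^sub>0) \<noteq> \<psi> (spider_par x\<^sub>0)"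
  proof -
    obtain s i k where x0': "x\<^sub>0 = Leg s i k" "(s, i) \<in> leg_index" "1 \<le> k" "k \<le> leg_length s i"
      using x0 by (rule in_N_cases)
    have "leg_vertex s i (k - 1) = Hub s" using psi_par[OF x0] nex x0'(1) by simp
    then have k: "k = 1" using x0'(3) by (cases "k - 1") auto
    obtain y where y: "y \<in> pverts D" "\<psi> y = par (\<psi> x\<^sub>0)" "\<alpha> y = \<alpha> x\<^sub>0" "t x\<^sub>0 = t y + (h y - \<alpha> y)"
      using t_branch[OF x0 nex] by blast
    \<comment> \<open>A hub \<open>y\<close> would be the hub of the same side, and the leg would
      not have been moved.\<close>
    have "y \<in> S.N"
    proof (rule ccontr)
      assume "y \<notin> S.N"
      then obtain s' where s': "y = Hub s'" using y(1) by blast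
      have "s' = s"
        using psi_side[OF y(1)] psi_side[of x\<^sub>0] T.side_par[OF psi_in_N[OF x0]] x0 y(2) s' x0'(1) by simp
      then show False using nex y(2) s' x0'(1) k by simp
    qed
    then have "0 < (h y - \<alpha> y) * \<alpha> y" by (rule strictly_outward) (simp add: \<alpha>_def \<alpha>_neq)
    then have t0: "0 < t x\<^sub>0 * \<alpha> x\<^sub>0"
      using t_outward[OF y(1)] y(3,4) by (simp add: distrib_right)
    \<comment> \<open>Below its head the leg is intact, so the shift arrives unchanged at the leaf,
      where it enters the sum.\<close>
    have along: "t (Leg s i (Suc j)) = t x\<^sub>0" if "Suc j \<le> leg_length s i" for j
      using that
    proof (induction j)
      case 0
      then show ?case using x0'(1) k by simp
    next
      case (Suc j)
      then have N: "Leg s i (Suc (Suc j)) \<in> S.N" using x0'(2) by (auto simp only: Leg_in_N_iff)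
      then have "par (\<psi> (Leg s i (Suc (Suc j)))) = \<psi> (spider_par (Leg s i (Suc (Suc j))))"
        using psi_par by fastforce
      then show ?case using t_straight[OF N] Suc by simp
    qed
    let ?x = "Leg s i (leg_length s i)"
    have x: "?x \<in> leaves D" using x0'(2) unfolding spider_leaves_eq by force
    have "t ?x = t x\<^sub>0" using along[of "leg_length s i - 1"] leg_length_bounds[OF x0'(2)] by simp
    moreover have "\<alpha> ?x = \<alpha> x\<^sub>0" by (simp add: \<alpha>_def x0'(1))
    ultimately have tx: "0 < t ?x * \<alpha> ?x" using t0 by simp
    obtain c where c: "h ?x = c * \<alpha> ?x" "c > 0" using leaf[OF x] \<alpha>_neq by (auto simp: \<alpha>_def)
    have "0 < c * (t ?x * \<alpha> ?x)" using c(2) tx by (rule mult_pos_pos)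
    also have "\<dots> = h ?x * t ?x" unfolding c(1) by simp
    finally have "0 < h ?x * t ?x" .
    then have "0 < (\<Sum>x\<in>leaves D. h x * t x)"
      using S.steklov.finite_leaves x ht by (intro sum_pos2[of _ ?x]) auto
    then have "steklov_lambda2 T * 1 < steklov_lambda2 T * (1 + 2 * (\<Sum>x\<in>leaves D. h x * t x))"
      using T.steklov.steklov_lambda2_pos by (intro mult_strict_left_mono) auto
    with shift show ?thesis by simp
  qed
qed

text \<open>Apart from the central edge all arcs join a vertex to its parent, so commuting with
  parents makes \<open>\<phi>\<close> an isomorphism.\<close>

lemma straight_imp_double_spider:
  assumes "\<And>x. x \<in> S.N \<Longrightarrow> par (\<psi> x) = \<psi> (spider_par x)" and "spider_params as bs"
  shows "is_double_spider T"
proof -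
  have inj: "inj_on \<phi> (pverts T)" and img: "\<phi> ` pverts T = pverts D"
    using bij_betw_inv_into[OF bij] by (auto simp: bij_betw_def)
  have par: "\<phi> (par (\<psi> x)) = spider_par x" if "x \<in> S.N" for x
    using assms(1)[OF that] phi_psi[OF S.par_in_verts[OF that]] by simp
  have uv: "\<phi> u = Hub True" "\<phi> v = Hub False"
    using psi_Hub[of True] psi_Hub[of False] phi_psi[of "Hub True"] phi_psi[of "Hub False"] hubs_in_verts
    by (auto simp: T.hub_def)
  have N: "T.N = \<psi> ` S.N" using bij_N by (simp add: bij_betw_def)
  have arcs: "map_prod \<phi> \<phi> ` parcs T = parcs D"
    unfolding T.arcs_eq S.arcs_eq N image_Un image_image image_insert image_empty map_prod_simp uv
    by (intro arg_cong2[of _ _ _ _ "(\<union>)"] image_cong refl) (auto simp: par phi_psi)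
  let ?f = "\<lparr>iso_verts = \<phi>, iso_arcs = map_prod \<phi> \<phi>, iso_head = snd, iso_tail = fst\<rparr>"
  have "inj_on (map_prod \<phi> \<phi>) (parcs T)"
    using map_prod_inj_on[OF inj inj] T.arcs_subset by (rule inj_on_subset)
  moreover have "wf_digraph (with_proj T)"
    using T.wf by (simp add: wf_digraph_wp_iff)
  ultimately have "pre_digraph.digraph_isomorphism (with_proj T) ?f"
    using inj by (simp add: pre_digraph.digraph_isomorphism_def)
  moreover have "with_proj D = app_iso ?f (with_proj T)"
    unfolding app_iso_def with_proj_def using img arcs by simp
  ultimately have "digraph_iso (with_proj T) (with_proj D)" unfolding digraph_iso_def by blast
  then show ?thesis using assms(2) unfolding is_double_spider_def by blast
qed

end

section \<open>Decomposing a tree into legs\<close>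

context deep_hub_tree
begin

definition deepest :: "bool \<Rightarrow> 'a" where
  "deepest s = (SOME w. w \<in> V \<and> side w = s \<and> dep w = r)"

text \<open>The bound \<open>j < r\<close> stops at depth 1 and leaves out the hub.\<close>

definition spine :: "'a set" where
  "spine = {(par ^^ j) (deepest s) | s j. j < r}"

text \<open>
  Following a spine whenever possible makes one path on each side run from a child of the
  hub down to depth \<open>r\<close>.
\<close>

definition preferred_child :: "'a \<Rightarrow> 'a" where
  "preferred_child w =
     (if \<exists>z\<in>N \<inter> spine. par z = w then SOME z. z \<in> N \<inter> spine \<and> par z = w
      else SOME z. z \<in> N \<and> par z = w)"

text \<open>The number of vertices on the path from \<open>z\<close> down to its leaf, and thus the
  length of the leg after \<open>z\<close> is attached to a hub: \<open>Suc\<close> counts the edge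
  above \<open>z\<close>.\<close>

definition leg_size :: "'a \<Rightarrow> nat" where
  "leg_size z = Suc (LEAST j. (preferred_child ^^ j) z \<in> leaves G)"

text \<open>Hubs belong to no path, so each child of a hub starts one.\<close>

definition heads :: "bool \<Rightarrow> 'a set" where
  "heads s = {z \<in> N. side z = s \<and> (par z \<in> N \<longrightarrow> preferred_child (par z) \<noteq> z)}"

lemma deepest: "deepest s \<in> V" "side (deepest s) = s" "dep (deepest s) = r"
proof -
  have "\<exists>w. w \<in> V \<and> side w = s \<and> dep w = r" using dep_attained by blast
  then have "deepest s \<in> V \<and> side (deepest s) = s \<and> dep (deepest s) = r"
    unfolding deepest_def by (rule someI_ex)
  then show "deepest s \<in> V" "side (deepest s) = s" "dep (deepest s) = r" by auto
qed

lemma par_iter: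
  assumes "w \<in> V" "j \<le> dep w"
  shows "(par ^^ j) w \<in> V \<and> dep ((par ^^ j) w) = dep w - j \<and> side ((par ^^ j) w) = side w"
  using assms(2)
proof (induction j)
  case (Suc j)
  then have IH: "(par ^^ j) w \<in> V" "dep ((par ^^ j) w) = dep w - j" "side ((par ^^ j) w) = side w"
    by auto
  then have "(par ^^ j) w \<in> N" unfolding in_N_iff using Suc.prems by simp
  from par_in_verts[OF this] dep_par[OF this] side_par[OF this] show ?case
    using IH by simp
qed (use assms(1) in simp)

text \<open>Each side has at most one spine vertex at each depth, so a choice among spine children
  is forced.\<close>

lemma spine_unique:
  assumes "x \<in> spine"
  shows "x = (par ^^ (r - dep x)) (deepest (side x))"
proof -
  obtain s j where j: "j < r" "x = (par ^^ j) (deepest s)" using assms unfolding spine_def by blast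
  then have "dep x = r - j" "side x = s" using par_iter[of "deepest s" j] deepest[of s] by auto
  then show ?thesis using j by simp
qed

lemma preferred_child:
  assumes "w \<in> N" "w \<notin> leaves G"
  shows "preferred_child w \<in> N" "par (preferred_child w) = w"
proof -
  have ex: "\<exists>z. z \<in> N \<and> par z = w" using assms unfolding leaves_eq by blast
  have "preferred_child w \<in> N \<and> par (preferred_child w) = w"
  proof (cases "\<exists>z\<in>N \<inter> spine. par z = w")
    case True
    then have "\<exists>z. z \<in> N \<inter> spine \<and> par z = w" by blast
    from someI_ex[OF this] show ?thesis unfolding preferred_child_def using True by simp
  next
    case False
    from someI_ex[OF ex] show ?thesis unfolding preferred_child_def using False by simp
  qed
  then show "preferred_child w \<in> N" "par (preferred_child w) = w" by auto
qed

lemma preferred_child_spine: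
  assumes "z \<in> N" "z \<in> spine"
  shows "preferred_child (par z) = z"
proof -
  let ?w = "par z"
  have "\<exists>x. x \<in> N \<inter> spine \<and> par x = ?w" using assms by blast
  from someI_ex[OF this] have p: "preferred_child ?w \<in> N" "preferred_child ?w \<in> spine"
    "par (preferred_child ?w) = ?w"
    unfolding preferred_child_def using assms by auto
  have "dep (preferred_child ?w) = dep z" "side (preferred_child ?w) = side z"
    using dep_par[OF p(1)] side_par[OF p(1)] dep_par[OF assms(1)] side_par[OF assms(1)] p(3) by auto
  then show ?thesis using spine_unique[OF p(2)] spine_unique[OF assms(2)] by simp
qed

section \<open>Paths along preferred children\<close>

lemma preferred_iter:
  assumes "z \<in> N" "\<And>i. i < j \<Longrightarrow> (preferred_child ^^ i) z \<notin> leaves G"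
  shows "(preferred_child ^^ j) z \<in> N \<and> dep ((preferred_child ^^ j) z) = dep z + j \<and>
    side ((preferred_child ^^ j) z) = side z"
  using assms(2)
proof (induction j)
  case (Suc j)
  let ?x = "(preferred_child ^^ j) z"
  have IH: "?x \<in> N" "dep ?x = dep z + j" "side ?x = side z" using Suc by auto
  note p = preferred_child[OF IH(1) Suc.prems[OF lessI]]
  show ?case using p dep_par[OF p(1)] side_par[OF p(1)] IH by simp
qed (use assms(1) in simp)

text \<open>Each step increases the depth, which is bounded by \<open>r\<close>, so the descent
  meets a leaf.\<close>

lemma leg_size_Least:
  assumes z: "z \<in> N"
  obtains m where "leg_size z = Suc m" "(preferred_child ^^ m) z \<in> leaves G"
    "\<And>i. i < m \<Longrightarrow> (preferred_child ^^ i) z \<notin> leaves G"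
proof -
  let ?P = "\<lambda>j. (preferred_child ^^ j) z \<in> leaves G"
  have "\<exists>j. ?P j"
  proof (rule ccontr)
    assume neg: "\<nexists>j. ?P j"
    have "(preferred_child ^^ r) z \<in> N" "dep ((preferred_child ^^ r) z) = dep z + r"
      using preferred_iter[OF z, of r] neg by blast+
    moreover have "0 < dep z" using z in_N_iff by blast
    ultimately show False using dep_le[of "(preferred_child ^^ r) z"] by simp
  qed
  then have "?P (LEAST j. ?P j)" by (rule LeastI_ex)
  moreover have "\<not> ?P i" if "i < (LEAST j. ?P j)" for i using that by (rule not_less_Least)
  ultimately show thesis by (intro that[of "LEAST j. ?P j"]) (simp_all add: leg_size_def)
qed

lemma leg_iter:
  assumes z: "z \<in> N" and j: "j < leg_size z"
  shows "(preferred_child ^^ j) z \<in> N" "dep ((preferred_child ^^ j) z) = dep z + j"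
    "side ((preferred_child ^^ j) z) = side z"
    "(preferred_child ^^ j) z \<in> leaves G \<longleftrightarrow> Suc j = leg_size z"
proof -
  obtain m where m: "leg_size z = Suc m" "(preferred_child ^^ m) z \<in> leaves G"
    "\<And>i. i < m \<Longrightarrow> (preferred_child ^^ i) z \<notin> leaves G"
    by (rule leg_size_Least[OF z]) blast
  have "i < j \<Longrightarrow> (preferred_child ^^ i) z \<notin> leaves G" for i using j m by simp
  from preferred_iter[OF z this] show "(preferred_child ^^ j) z \<in> N"
    "dep ((preferred_child ^^ j) z) = dep z + j" "side ((preferred_child ^^ j) z) = side z" by auto
  show "(preferred_child ^^ j) z \<in> leaves G \<longleftrightarrow> Suc j = leg_size z"
    using j m by (cases "j = m") auto
qed

lemma par_leg_iter:
  assumes z: "z \<in> N" and j: "Suc j < leg_size z"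
  shows "par ((preferred_child ^^ Suc j) z) = (preferred_child ^^ j) z"
proof -
  have "(preferred_child ^^ j) z \<notin> leaves G" using leg_iter(4)[OF z, of j] j by simp
  then show ?thesis using preferred_child(2)[OF leg_iter(1)[OF z, of j]] j by simp
qed

text \<open>A path starts at depth at least 1 and ends at depth at most \<open>r\<close>; moving it
  up to a hub keeps the leg within \<open>r\<close>.\<close>

lemma leg_size_le: "z \<in> N \<Longrightarrow> leg_size z \<le> r"
proof -
  assume z: "z \<in> N"
  obtain m where m: "leg_size z = Suc m" by (simp add: leg_size_def)
  have "dep z + m \<le> r" using leg_iter(1,2)[OF z, of m] m dep_le[of "(preferred_child ^^ m) z"] by auto
  moreover have "0 < dep z" using z in_N_iff by blast
  ultimately show ?thesis using m by simp
qed

lemma full_head: "\<exists>z\<in>heads s. leg_size z = r"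
proof -
  \<comment> \<open>\<open>y j\<close> is the spine vertex at depth \<open>j + 1\<close>; the path
    starting at \<open>y 0\<close> follows the spine.\<close>
  define y where "y j = (par ^^ (r - 1 - j)) (deepest s)" for j
  have y: "y j \<in> N" "y j \<in> spine" "dep (y j) = Suc j" "side (y j) = s" if "j < r" for j
  proof -
    have *: "y j \<in> V" "dep (y j) = Suc j" "side (y j) = s"
      using par_iter[of "deepest s" "r - 1 - j"] deepest[of s] that by (auto simp: y_def)
    then show "y j \<in> N" "dep (y j) = Suc j" "side (y j) = s" unfolding in_N_iff by auto
    have "r - 1 - j < r" using r_pos by simp
    then show "y j \<in> spine" unfolding spine_def y_def by blast
  qed
  have par_y: "par (y (Suc j)) = y j" if "Suc j < r" for j
  proof -
    have "r - 1 - j = Suc (r - 1 - Suc j)" using that by simp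
    then show ?thesis by (simp add: y_def)
  qed
  have iter: "(preferred_child ^^ j) (y 0) = y j" if "j < r" for j
    using that
  proof (induction j)
    case (Suc j)
    then show ?case using preferred_child_spine[OF y(1,2)[OF Suc.prems]] par_y[OF Suc.prems] by simp
  qed simp
  have 0: "0 < r" using r_pos by simp
  have "dep (par (y 0)) = 0" using dep_par[OF y(1)[OF 0]] y(3)[OF 0] by simp
  then have "par (y 0) \<notin> N" unfolding in_N_iff by simp
  then have "y 0 \<in> heads s" using y[OF 0] unfolding heads_def by blast
  moreover have "leg_size (y 0) = r"
  \<comment> \<open>A shorter path would end at a leaf \<open>y m\<close>, which has the child
    \<open>y (Suc m)\<close>.\<close>
  proof (rule antisym[OF leg_size_le[OF y(1)[OF 0]]], rule ccontr)
    assume "\<not> r \<le> leg_size (y 0)"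
    moreover obtain m where m: "leg_size (y 0) = Suc m" by (simp add: leg_size_def)
    ultimately have r: "Suc m < r" by simp
    have "y m \<in> leaves G" using leg_iter(4)[OF y(1)[OF 0], of m] m iter[of m] r by simp
    moreover have "y (Suc m) \<in> N" "par (y (Suc m)) = y m" using y(1)[OF r] par_y[OF r] .
    ultimately show False unfolding leaves_eq by blast
  qed
  ultimately show ?thesis by blast
qed

lemma heads_in_N: "z \<in> heads s \<Longrightarrow> z \<in> N"
  by (simp add: heads_def)

lemma head_neq_leg_iter:
  assumes "z \<in> heads s" "z' \<in> heads s'" "Suc j < leg_size z'"
  shows "z \<noteq> (preferred_child ^^ Suc j) z'"
proof
  assume eq: "z = (preferred_child ^^ Suc j) z'"
  then have "par z = (preferred_child ^^ j) z'"
    using par_leg_iter[OF heads_in_N[OF assms(2)] assms(3)] by simp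
  then have "par z \<in> N" "preferred_child (par z) = z"
    using leg_iter(1)[OF heads_in_N[OF assms(2)], of j] assms(3) eq by auto
  then show False using assms(1) by (simp add: heads_def)
qed

text \<open>Climbing from a common vertex along both paths reaches a head on both at the same
  moment, because a head is never a later vertex of a path.\<close>

lemma legs_disjoint:
  assumes "z \<in> heads s" "z' \<in> heads s'" "j < leg_size z" "j' < leg_size z'"
    and "(preferred_child ^^ j) z = (preferred_child ^^ j') z'"
  shows "z = z' \<and> j = j'"
  using assms(3-5)
proof (induction j arbitrary: j')
  case 0
  show ?case
  proof (cases j')
    case (Suc i)
    then show ?thesis using head_neq_leg_iter[OF assms(1,2), of i] 0 by simp
  qed (use 0 in simp)
next
  case (Suc j)
  show ?case
  proof (cases j')
    case 0
    then show ?thesis using head_neq_leg_iter[OF assms(2,1), of j] Suc.prems by simp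
  next
    case (Suc i)
    have "(preferred_child ^^ j) z = (preferred_child ^^ i) z'"
      using par_leg_iter[OF heads_in_N[OF assms(1)], of j] par_leg_iter[OF heads_in_N[OF assms(2)], of i]
        Suc.prems Suc by metis
    then show ?thesis using Suc.IH[of i] Suc.prems Suc by simp
  qed
qed

text \<open>Climb from \<open>w\<close> until the vertex is not the preferred child of its parent or
  its parent is a hub.\<close>

lemma legs_cover: "w \<in> N \<Longrightarrow> \<exists>z\<in>heads (side w). \<exists>j<leg_size z. (preferred_child ^^ j) z = w"
proof (induction "dep w" arbitrary: w rule: less_induct)
  case less
  show ?case
  proof (cases "w \<in> heads (side w)")
    case True
    then show ?thesis by (intro bexI[of _ w] exI[of _ 0]) (auto simp: leg_size_def)
  next
    case False
    then have p: "par w \<in> N" "preferred_child (par w) = w" using less(2) by (auto simp: heads_def)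
    obtain z j where z: "z \<in> heads (side w)" "j < leg_size z" "(preferred_child ^^ j) z = par w"
      using less(1)[OF _ p(1)] dep_par[OF less(2)] side_par[OF less(2)] by auto
    have "par w \<notin> leaves G" using less(2) unfolding leaves_eq by blast
    then have "Suc j < leg_size z"
      using leg_iter(4)[OF heads_in_N[OF z(1)] z(2)] z by (auto simp: Suc_le_eq le_less)
    then show ?thesis using z p(2) by (intro bexI[of _ z] exI[of _ "Suc j"]) auto
  qed
qed

section \<open>Assembling the paths into a double spider\<close>

lemma sorted_heads:
  obtains hs where "distinct hs" "set hs = heads s" "sorted_wrt (\<ge>) (map leg_size hs)"
proof -
  have "finite (heads s)" using finite_verts by (auto simp: heads_def)
  then obtain xs where xs: "set xs = heads s" "distinct xs" using finite_distinct_list by blast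
  have "sorted_wrt (\<ge>) (map leg_size (rev (sort_key leg_size xs)))"
    by (simp only: rev_map[symmetric] sorted_wrt_rev) simp
  then show thesis using xs by (intro that[of "rev (sort_key leg_size xs)"]) auto
qed

text \<open>Position 1 on a leg is the head of its path, hence \<open>k - 1\<close> steps
  down.\<close>

definition leg_map :: "(bool \<Rightarrow> 'a list) \<Rightarrow> spider_vertex \<Rightarrow> 'a" where
  "leg_map hs x = (case x of Hub s \<Rightarrow> hub s | Leg s i k \<Rightarrow> (preferred_child ^^ (k - 1)) (hs s ! i))"

lemma leg_map_simps [simp]:
  "leg_map hs (Hub s) = hub s"
  "leg_map hs (Leg s i k) = (preferred_child ^^ (k - 1)) (hs s ! i)"
  by (simp_all add: leg_map_def)

lemma spider_unfolding_exists:
  "\<exists>as bs \<psi>. spider_params as bs \<and> hd as = r \<and> hd bs = r \<and>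
     spider_unfolding G u v par dep side r as bs \<psi>"
proof -
  have "\<exists>hs. distinct hs \<and> set hs = heads s \<and> sorted_wrt (\<ge>) (map leg_size hs)" for s
    using sorted_heads[of s] by metis
  then obtain hs where hs: "\<And>s. distinct (hs s)" "\<And>s. set (hs s) = heads s"
    "\<And>s. sorted_wrt (\<ge>) (map leg_size (hs s))" by metis
  define l where "l s = map leg_size (hs s)" for s
  have bounds: "1 \<le> a \<and> a \<le> r" if "a \<in> set (l s)" for a s
    using that hs(2) leg_size_le heads_in_N by (auto simp: l_def leg_size_def)
  have r_in: "r \<in> set (l s)" for s
    using full_head[of s] hs(2) by (auto simp: l_def intro: rev_image_eqI)
  \<comment> \<open>The list is nonincreasing, contains \<open>r\<close> and is bounded by
    \<open>r\<close>, so it begins with \<open>r\<close>.\<close>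
  have hd_l: "hd (l s) = r" for s
  proof -
    obtain a as where as: "l s = a # as" using r_in[of s] by (cases "l s") auto
    have "r \<le> a" using r_in[of s] hs(3)[of s] unfolding l_def[symmetric] as by auto
    then show ?thesis using bounds[of a s] as by simp
  qed
  have params: "spider_params (l True) (l False)"
    unfolding spider_params_def
    using bounds hs(3) r_in[of True] r_in[of False] by (auto simp: l_def[symmetric])
  interpret bounded_spider "l True" "l False" r
    using bounds r_in r_pos by unfold_locales auto
  have legs: "legs s = l s" for s by (simp add: legs_def)
  have l: "length (l s) = length (hs s)" "i < length (hs s) \<Longrightarrow> l s ! i = leg_size (hs s ! i)" for s i
    by (simp_all add: l_def)
  have index: "(s, i) \<in> leg_index \<longleftrightarrow> i < length (hs s)" for s i
    by (simp add: leg_index_def legs l)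
  have len: "leg_length s i = leg_size (hs s ! i)" if "i < length (hs s)" for s i
    using that by (simp add: leg_length_def legs l)
  have head: "hs s ! i \<in> heads s" if "i < length (hs s)" for s i
    using that hs(2) nth_mem by blast
  let ?\<psi> = "leg_map hs"
  have leg: "?\<psi> x \<in> N" "side (?\<psi> x) = spider_side x" "?\<psi> x \<in> leaves G \<longleftrightarrow> x \<in> leaves D"
    "par (?\<psi> x) = ?\<psi> (spider_par x) \<or> spider_par x = Hub (spider_side x)"
    if x: "x \<in> S.N" for x
  proof -
    obtain s i k where *: "x = Leg s i k" "i < length (hs s)" "1 \<le> k" "k \<le> leg_size (hs s ! i)"
      using in_N_cases[OF x] index len by metis
    note z = head[OF *(2)] heads_in_N[OF head[OF *(2)]]
    have k: "k - 1 < leg_size (hs s ! i)" using * by simp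
    show "?\<psi> x \<in> N" using leg_iter(1)[OF z(2) k] * by simp
    show "side (?\<psi> x) = spider_side x" using leg_iter(3)[OF z(2) k] * z(1) by (simp add: heads_def)
    have "x \<in> leaves D \<longleftrightarrow> k = leg_length s i"
      using *(1,2) index unfolding spider_leaves_eq by auto
    then show "?\<psi> x \<in> leaves G \<longleftrightarrow> x \<in> leaves D"
      using leg_iter(4)[OF z(2) k] * len[OF *(2)] by simp
    show "par (?\<psi> x) = ?\<psi> (spider_par x) \<or> spider_par x = Hub (spider_side x)"
    proof (cases "k = 1")
      case False
      then obtain j where j: "k = Suc (Suc j)" using *(3) by (cases k rule: nat.exhaust; cases "k - 1") auto
      then show ?thesis using par_leg_iter[OF z(2), of j] * by simp
    qed (use * in simp)
  qed
  have bij: "bij_betw ?\<psi> S.N N"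
  proof (rule bij_betw_imageI)
    show "inj_on ?\<psi> S.N"
    proof (rule inj_onI)
      fix x y assume xy: "x \<in> S.N" "y \<in> S.N" "?\<psi> x = ?\<psi> y"
      obtain s i k where x: "x = Leg s i k" "i < length (hs s)" "1 \<le> k" "k \<le> leg_size (hs s ! i)"
        using in_N_cases[OF xy(1)] index len by metis
      obtain s' i' k' where y: "y = Leg s' i' k'" "i' < length (hs s')" "1 \<le> k'" "k' \<le> leg_size (hs s' ! i')"
        using in_N_cases[OF xy(2)] index len by metis
      \<comment> \<open>Disjointness recovers the head and the position; the side and the
        distinctness of \<open>hs s\<close> then recover the index.\<close>
      have "hs s ! i = hs s' ! i' \<and> k - 1 = k' - 1"
        using x y xy(3) by (intro legs_disjoint[OF head[OF x(2)] head[OF y(2)]]) auto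
      moreover have "s = s'" using leg(2)[OF xy(1)] leg(2)[OF xy(2)] xy(3) x(1) y(1) by simp
      ultimately have "i = i'" "k = k'"
        using x y hs(1)[of s] by (auto simp: nth_eq_iff_index_eq)
      then show "x = y" using x y \<open>s = s'\<close> by simp
    qed
    show "?\<psi> ` S.N = N"
    proof
      show "?\<psi> ` S.N \<subseteq> N" by (intro image_subsetI leg(1))
      show "N \<subseteq> ?\<psi> ` S.N"
      proof
        fix w assume "w \<in> N"
        then obtain z j where z: "z \<in> heads (side w)" "j < leg_size z" "(preferred_child ^^ j) z = w"
          using legs_cover by blast
        then obtain i where i: "i < length (hs (side w))" "hs (side w) ! i = z"
          using hs(2) by (metis in_set_conv_nth)
        have "Leg (side w) i (Suc j) \<in> S.N"
          unfolding Leg_in_N_iff using i z index len by simp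
        moreover have "w = ?\<psi> (Leg (side w) i (Suc j))" using i z by simp
        ultimately show "w \<in> ?\<psi> ` S.N" by (rule rev_image_eqI)
      qed
    qed
  qed
  have "bij_betw ?\<psi> {Hub True, Hub False} {u, v}"
    using hubs_neq by (auto simp: bij_betw_def hub_def)
  then have "bij_betw ?\<psi> ({Hub True, Hub False} \<union> S.N) ({u, v} \<union> N)"
    by (rule bij_betw_combine[OF _ bij]) blast
  moreover have "{Hub True, Hub False} \<union> S.N = pverts D" using hubs_in_verts by blast
  moreover have "{u, v} \<union> N = V" using hub_in_verts by blast
  ultimately have bijV: "bij_betw ?\<psi> (pverts D) V" by simp
  have hub_not_leaf: "hub s \<notin> leaves G" "Hub s \<notin> leaves D" for s
    unfolding leaves_eq S.leaves_eq by (auto simp: hub_def)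
  have cases: "x \<in> S.N \<or> (\<exists>s. x = Hub s)" if "x \<in> pverts D" for x using that by blast
  have "spider_unfolding G u v par dep side r (l True) (l False) ?\<psi>"
  proof (intro spider_unfolding.intro spider_unfolding_axioms.intro)
    show "side (?\<psi> x) = spider_side x" "?\<psi> x \<in> leaves G \<longleftrightarrow> x \<in> leaves D"
      if "x \<in> pverts D" for x
      using cases[OF that] leg(2,3) hub_not_leaf by auto
  qed (use bijV leg(4) in \<open>auto intro: deep_hub_tree_axioms bounded_spider_axioms\<close>)
  then show ?thesis using params hd_l by blast
qed

end

theorem theorem3p6:
  fixes T :: "'a pair_pre_digraph" and r n :: nat
  assumes "1 \<le> r"
    and "tree_graph T"
    and "graph_diameter T = ereal (real (2 * r + 1))"
    and "card (pverts T) = n"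
  shows "\<exists>as bs. spider_params as bs \<and>
    card (pverts (double_spider as bs)) = n \<and>
    graph_diameter (double_spider as bs) = ereal (real (2 * r + 1)) \<and>
    hd as = r \<and> hd bs = r \<and>
    (\<forall>a\<in>set as. a \<le> r) \<and> (\<forall>b\<in>set bs. b \<le> r) \<and>
    steklov_lambda2 T \<le> steklov_lambda2 (double_spider as bs) \<and>
    (steklov_lambda2 T = steklov_lambda2 (double_spider as bs) \<longrightarrow> is_double_spider T)"
proof -
  obtain u v par dep side where "deep_hub_tree T u v par dep side r"
    using tree_graph_imp_deep_hub_tree[OF assms(1-3)] by blast
  then interpret deep_hub_tree T u v par dep side r .
  obtain as bs \<psi> where params: "spider_params as bs" "hd as = r" "hd bs = r"
    and "spider_unfolding T u v par dep side r as bs \<psi>"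
    using spider_unfolding_exists by blast
  then interpret U: spider_unfolding T u v par dep side r as bs \<psi> by simp
  have "card (pverts (double_spider as bs)) = n"
    using bij_betw_same_card[OF U.bij] assms(4) by simp
  \<comment> \<open>A single moved leg would make the inequality strict.\<close>
  moreover have "is_double_spider T" if "steklov_lambda2 T = steklov_lambda2 (double_spider as bs)"
  proof (rule U.straight_imp_double_spider[OF _ params(1)])
    show "par (\<psi> x) = \<psi> (spider_par x)" if "x \<in> U.S.N" for x
      using U.steklov_lambda2_less_spider[OF that] \<open>steklov_lambda2 T = _\<close> by auto
  qed
  moreover have "(\<forall>a\<in>set as. a \<le> r) \<and> (\<forall>b\<in>set bs. b \<le> r)" using U.legs_bounds by blast
  ultimately show ?thesis
    using params U.steklov_lambda2_le_spider U.S.graph_diameter by blast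
qed

end
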